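(* Let ${\rm F}$ be a $d$-type branching forest with progeny law $\nu$. \begin{itemize} \item[1.] For any ${\rm c}=(c_1,c_2,\dots)\in [d]^\infty$, under ${\bf P}_{\rm c}$, the chains $X^{(i)}=(X^{i,1},\dots,X^{i,d})$, $i=1,\dots,d$, are independent random walks with step distribution \[{\bf P}_{\rm c}\Big(X^{(i)}_1=(q_1,\dots,q_d)\Big)=\nu_i(q_1,\dots,q_{i-1},q_i+1,q_{i+1},\dots,q_d)\,.\] In particular, their laws do not depend on ${\rm c}$. For each $i\in [d]$, $X^{i,i}$ is a downward skip free random walk such that $\liminf_{n\rightarrow+\infty}X_n^{i,i}=-\infty$ a.s., and for $j\neq i$, $X^{i,j}$ is a renewal process. \item[2.] For every integer $r\ge1$, almost surely there is ${\rm r}=(r_1,\dots,r_d)\in \mathbb{Z}_+^d$ with $r=r_1+\dots+r_d$ such that there is a smallest solution ${\rm n}$ to the system $({\rm r},X)$. \item[3.] Conversely, let $Y$ be a copy of $X$ and ${\rm c}=(c_1,c_2,\dots)\in [d]^\infty$. Then to $Y$ and ${\rm c}$ we may associate a unique $d$-type branching forest, with progeny law $\nu$ and root type sequence ${\rm c}$ (i.e. the $k$-th tree has root of type $c_k$), whose coding random walk (constructed from the forest as $X$ is constructed from ${\rm F}$) is $Y$. \end{itemize}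
   Context: Let $d\ge2$, $[n]=\{1,\dots,n\}$. Let $\nu=(\nu_1,\dots,\nu_d)$ be distributions on $\mathbb{Z}_+^d$ forming the progeny law of an irreducible, non-degenerated, critical or subcritical $d$-type branching process (an individual of type $i$ has offspring vector, giving the number of children of each type, with law $\nu_i$, independently of other individuals), so that the process becomes extinct a.s. On a probability space $(\Omega,\mathcal{G},P)$, let $({\bf P}_{\rm c})_{{\rm c}\in[d]^\infty}$ be probability measures and ${\rm F}=({\rm T}_k)_{k\ge1}$ an infinite sequence of independent random plane trees such that under ${\bf P}_{\rm c}$, ${\rm T}_k$ is a branching tree with progeny law $\nu$ whose root has type $c_k$; ${\rm F}$ is called a $d$-type branching forest with progeny law $\nu$. In a plane forest, children of a common parent are ordered with nondecreasing types, and vertices are labeled in breadth first search order (trees in order, each tree read generation by generation from its root, each generation from left to right). A subtree of type $i$ is a maximal connected subgraph all of whose vertices have type $i$; the subforest ${\rm F}^{(i)}$ of type $i$ is the forest of these subtrees ranked by the order of their roots, and $({\rm u}^{(i)}_n)_{n\ge1}$ denotes its vertices in its own breadth first search order (${\rm F}^{(i)}$ is a.s. infinite). For a vertex $u$, $p_j(u)$ is its number of children of type $j$. The coding walk $X=(X^{(1)},\dots,X^{(d)})$, $X^{(i)}=(X^{i,1},\dots,X^{i,d})$, is defined by $X_0^{(i)}=0$ and, for $n\ge0$, $X_{n+1}^{i,j}-X_n^{i,j}=p_j({\rm u}_{n+1}^{(i)})$ if $i\neq j$, and $X_{n+1}^{i,i}-X_n^{i,i}=p_i({\rm u}_{n+1}^{(i)})-1$.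 For ${\rm r}\in\mathbb{Z}_+^d$, the system $({\rm r},X)$ is the set of equations $r_j+\sum_{i=1}^d X^{i,j}(s_i)=0$, $j=1,\dots,d$, in ${\rm s}=(s_1,\dots,s_d)\in\mathbb{Z}_+^d$; a solution ${\rm n}$ is the smallest solution if ${\rm n}\le{\rm s}$ componentwise for every solution ${\rm s}$ (when a solution exists, a unique smallest one exists). *)

theory Defs
  imports "HOL-Probability.Probability"
begin

text \<open>Types are the elements of a finite linearly ordered type 't (playing the role of [d]).
  A finite plane tree is a node carrying its type and the ordered list of its children.
  A vertex is represented by the subtree rooted at it; vertex lists below are
  always lists of occurrences, so repeated values are distinct vertices.\<close>

datatype 't ttree = Node 't "'t ttree list"

primrec rtype :: "'t ttree \<Rightarrow> 't" where
  "rtype (Node a ts) = a"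

primrec kids :: "'t ttree \<Rightarrow> 't ttree list" where
  "kids (Node a ts) = ts"

fun wf_tree :: "('t::linorder) ttree \<Rightarrow> bool" where
  "wf_tree (Node a ts) = (sorted (map rtype ts) \<and> (\<forall>s\<in>set ts. wf_tree s))"

definition offspring :: "'t ttree \<Rightarrow> 't \<Rightarrow> nat" where
  "offspring u j = length (filter (\<lambda>s. rtype s = j) (kids u))"

primrec level :: "nat \<Rightarrow> 't ttree \<Rightarrow> 't ttree list" where
  "level 0 t = [t]"
| "level (Suc n) t = concat (map (level n) (kids t))"

definition bfs :: "'t ttree \<Rightarrow> 't ttree list" where
  "bfs t = concat (map (\<lambda>n. level n t) [0..<Suc (size t)])"

text \<open>Generation n (left to right) of the subtree of type i rooted at t (t of type i).\<close>
primrec ilevel :: "'t \<Rightarrow> nat \<Rightarrow> 't ttree \<Rightarrow> 't ttree list" where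
  "ilevel i 0 t = [t]"
| "ilevel i (Suc n) t = concat (map (ilevel i n) (filter (\<lambda>s. rtype s = i) (kids t)))"

definition ibfs :: "'t \<Rightarrow> 't ttree \<Rightarrow> 't ttree list" where
  "ibfs i t = concat (map (\<lambda>n. ilevel i n t) [0..<Suc (size t)])"

definition sub_roots :: "'t \<Rightarrow> 't ttree \<Rightarrow> 't ttree list" where
  "sub_roots i t = (if rtype t = i then [t] else []) @
     concat (map (\<lambda>u. if rtype u = i then [] else filter (\<lambda>s. rtype s = i) (kids u)) (bfs t))"

definition type_vertices :: "'t \<Rightarrow> 't ttree \<Rightarrow> 't ttree list" where
  "type_vertices i t = concat (map (ibfs i) (sub_roots i t))"

text \<open>A forest is a sequence f 0, f 1, ... of trees (the paper's T_1, T_2, ...).\<close>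
definition prefix_vertices :: "(nat \<Rightarrow> 't ttree) \<Rightarrow> 't \<Rightarrow> nat \<Rightarrow> 't ttree list" where
  "prefix_vertices f i m = concat (map (\<lambda>k. type_vertices i (f k)) [0..<m])"

definition subforest_infinite :: "(nat \<Rightarrow> 't ttree) \<Rightarrow> 't \<Rightarrow> bool" where
  "subforest_infinite f i \<longleftrightarrow> (\<forall>n. \<exists>m. n < length (prefix_vertices f i m))"

text \<open>vertex_seq f i n is the paper's u^(i)_(n+1).\<close>
definition vertex_seq :: "(nat \<Rightarrow> 't ttree) \<Rightarrow> 't \<Rightarrow> nat \<Rightarrow> 't ttree" where
  "vertex_seq f i n = prefix_vertices f i (LEAST m. n < length (prefix_vertices f i m)) ! n"

definition coding_walk :: "(nat \<Rightarrow> 't ttree) \<Rightarrow> 't \<Rightarrow> nat \<Rightarrow> 't \<Rightarrow> int" where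
  "coding_walk f i n j =
     (\<Sum>m<n. int (offspring (vertex_seq f i m) j) - (if j = i then 1 else 0))"

definition is_solution :: "('t::finite \<Rightarrow> nat) \<Rightarrow> ('t \<Rightarrow> nat \<Rightarrow> 't \<Rightarrow> int) \<Rightarrow> ('t \<Rightarrow> nat) \<Rightarrow> bool" where
  "is_solution r X s \<longleftrightarrow> (\<forall>j. int (r j) + (\<Sum>i\<in>UNIV. X i (s i) j) = 0)"

definition smallest_solution :: "('t::finite \<Rightarrow> nat) \<Rightarrow> ('t \<Rightarrow> nat \<Rightarrow> 't \<Rightarrow> int) \<Rightarrow> ('t \<Rightarrow> nat) \<Rightarrow> bool" where
  "smallest_solution r X n \<longleftrightarrow> is_solution r X n \<and> (\<forall>s. is_solution r X s \<longrightarrow> (\<forall>i. n i \<le> s i))"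

definition finite_means :: "('t \<Rightarrow> ('t \<Rightarrow> nat) pmf) \<Rightarrow> bool" where
  "finite_means \<nu> \<longleftrightarrow> (\<forall>i j. integrable (measure_pmf (\<nu> i)) (\<lambda>q. real (q j)))"

definition mean_matrix :: "('t \<Rightarrow> ('t \<Rightarrow> nat) pmf) \<Rightarrow> 't \<Rightarrow> 't \<Rightarrow> real" where
  "mean_matrix \<nu> i j = measure_pmf.expectation (\<nu> i) (\<lambda>q. real (q j))"

fun mat_pow :: "('t::finite \<Rightarrow> 't \<Rightarrow> real) \<Rightarrow> nat \<Rightarrow> 't \<Rightarrow> 't \<Rightarrow> real" where
  "mat_pow A 0 = (\<lambda>i j. if i = j then 1 else 0)"
| "mat_pow A (Suc n) = (\<lambda>i j. \<Sum>k\<in>UNIV. mat_pow A n i k * A k j)"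

definition spectral_radius_fun :: "('t::finite \<Rightarrow> 't \<Rightarrow> real) \<Rightarrow> real" where
  "spectral_radius_fun A = Sup {cmod l | l. \<exists>v :: 't \<Rightarrow> complex. (\<exists>j. v j \<noteq> 0) \<and>
       (\<forall>i. (\<Sum>j\<in>UNIV. complex_of_real (A i j) * v j) = l * v i)}"

definition irreducible_law :: "('t::finite \<Rightarrow> ('t \<Rightarrow> nat) pmf) \<Rightarrow> bool" where
  "irreducible_law \<nu> \<longleftrightarrow> (\<forall>i j. \<exists>n>0. mat_pow (mean_matrix \<nu>) n i j > 0)"

definition nondegenerate_law :: "('t::finite \<Rightarrow> ('t \<Rightarrow> nat) pmf) \<Rightarrow> bool" where
  "nondegenerate_law \<nu> \<longleftrightarrow> (\<exists>i. measure_pmf.prob (\<nu> i) {q. (\<Sum>j\<in>UNIV. q j) \<noteq> 1} > 0)"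

definition critical_or_subcritical :: "('t::finite \<Rightarrow> ('t \<Rightarrow> nat) pmf) \<Rightarrow> bool" where
  "critical_or_subcritical \<nu> \<longleftrightarrow> finite_means \<nu> \<and> spectral_radius_fun (mean_matrix \<nu>) \<le> 1"

definition gw_weight :: "('t::linorder \<Rightarrow> ('t \<Rightarrow> nat) pmf) \<Rightarrow> 't \<Rightarrow> 't ttree \<Rightarrow> real" where
  "gw_weight \<nu> i t = (if rtype t = i \<and> wf_tree t
      then (\<Prod>u\<leftarrow>bfs t. pmf (\<nu> (rtype u)) (offspring u)) else 0)"

definition branching_forest :: "'w measure \<Rightarrow> ('w \<Rightarrow> nat \<Rightarrow> ('t::linorder) ttree)
     \<Rightarrow> ('t \<Rightarrow> ('t \<Rightarrow> nat) pmf) \<Rightarrow> (nat \<Rightarrow> 't) \<Rightarrow> bool" where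
  "branching_forest M F \<nu> c \<longleftrightarrow> prob_space M \<and>
     prob_space.indep_vars M (\<lambda>_. count_space UNIV) (\<lambda>k \<omega>. F \<omega> k) UNIV \<and>
     (\<forall>k t. measure M {\<omega> \<in> space M. F \<omega> k = t} = gw_weight \<nu> (c k) t)"

definition step_prob :: "('t \<Rightarrow> ('t \<Rightarrow> nat) pmf) \<Rightarrow> 't \<Rightarrow> ('t \<Rightarrow> int) \<Rightarrow> real" where
  "step_prob \<nu> i q = (if (\<forall>j. 0 \<le> q j + (if j = i then 1 else 0))
      then pmf (\<nu> i) (\<lambda>j. nat (q j + (if j = i then 1 else 0))) else 0)"

definition path_space :: "('t \<Rightarrow> nat \<Rightarrow> 't \<Rightarrow> int) measure" where
  "path_space = Pi\<^sub>M UNIV (\<lambda>_. Pi\<^sub>M UNIV (\<lambda>_. Pi\<^sub>M UNIV (\<lambda>_. count_space UNIV)))"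

end

theory Submission
  imports Defs
begin

text \<open>Read the forest level by level. Once all one-type subtrees with root in the first \<open>n\<close>
  generations are known, so are the roots of the one-type subtrees in generation \<open>n + 1\<close>, and the
  next offspring vectors of type \<open>i\<close> determine the subtrees of type \<open>i\<close> below them. Hence at most
  one finite forest with given root types is coded by initial segments of an array \<open>x\<close> of offspring
  vectors. If \<open>x\<close> has independent entries with laws \<open>\<nu> i\<close>, then the probability that \<open>x\<close> codes a
  given forest is the product of the Galton-Watson weights of its trees. By hypothesis these weights
  sum to one, so \<open>x\<close> almost surely codes an infinite forest, which has the law of \<open>F\<close>. By
  irreducibility every type occurs infinitely often in it, so its offspring array is the whole of
  \<open>x\<close>; this identifies the law of the coding walk and shows that coding can be inverted.\<close>

text \<open>The obstacle to inverting the coding is that two orders run at different speeds: a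
  subtree of type \<open>i\<close> is read to its end, through many generations of the tree, before
  the next subtree of type \<open>i\<close> starts. Hence whole one-type subtrees are compared at
  once, in the form of the cut trees \<open>icut\<close>, instead of single vertices. Only
  uniqueness of decoding is proved for each single array. Existence can fail, for instance when a
  subtree never ends, and is a matter of comparing total mass. Extinction enters there, through the
  hypothesis that forests of finite trees with the Galton-Watson weights exist for every root
  sequence. Constant root sequences are used as well: they show that each type starts some tree of
  positive weight, which irreducibility then extends to trees of positive weight containing any
  given type. Part 2 involves no probability: a solution of the system comes from counting the
  vertices of the first \<open>r\<close> trees by type, and a lattice argument turns one solution
  into a smallest one.\<close>

section \<open>A forest is determined by its coding walk\<close>

text \<open>Two codes read from the same row of an array coincide as far as both reach, while
  nothing is known about their lengths. Equality of lengths has to be won back from the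
  content.\<close>

definition agree :: "'a list \<Rightarrow> 'a list \<Rightarrow> bool" where
  "agree xs ys \<longleftrightarrow> (\<forall>n. n < length xs \<longrightarrow> n < length ys \<longrightarrow> xs ! n = ys ! n)"

lemma agree_appendD:
  assumes "agree (a @ b) (a' @ b')" and "length a = length a'"
  shows "a = a'" and "agree b b'"
proof -
  show "a = a'"
  proof (rule nth_equalityI)
    fix n assume "n < length a"
    then show "a ! n = a' ! n"
      using assms(1)[unfolded agree_def, rule_format, of n] assms(2) by (simp add: nth_append)
  qed (fact assms(2))
  show "agree b b'"
    unfolding agree_def
  proof (intro allI impI)
    fix n assume "n < length b" "n < length b'"
    then show "b ! n = b' ! n"
      using assms(1)[unfolded agree_def, rule_format, of "length a + n"] assms(2)
      by (simp add: nth_append)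
  qed
qed

lemma agree_prefixD: "agree (a @ b) (a' @ b') \<Longrightarrow> agree a a'"
  unfolding agree_def
proof (intro allI impI)
  fix n assume "\<forall>n. n < length (a @ b) \<longrightarrow> n < length (a' @ b') \<longrightarrow> (a @ b) ! n = (a' @ b') ! n"
    and "n < length a" "n < length a'"
  then show "a ! n = a' ! n" by (auto simp: nth_append dest: spec[of _ n])
qed

text \<open>Equal earlier blocks have equal total length, so block \<open>n\<close> starts at the
  same position in both lists.\<close>

lemma agree_concat_step:
  assumes "agree (concat (map g [0..<N])) (concat (map g' [0..<N]))"
    and "\<And>m. m < n \<Longrightarrow> g m = g' m" and "n < N"
  shows "agree (g n) (g' n)"
proof -
  have "[0..<N] = [0..<n] @ n # [Suc n..<N]"
    using assms(3) upt_add_eq_append[of 0 n "N - n"] upt_conv_Cons[of n N] by simp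
  then have *: "agree (concat (map g [0..<n]) @ (g n @ concat (map g [Suc n..<N])))
                   (concat (map g' [0..<n]) @ (g' n @ concat (map g' [Suc n..<N])))"
    using assms(1) by simp
  have "map g [0..<n] = map g' [0..<n]"
    using assms(2) by simp
  then have "agree (g n @ concat (map g [Suc n..<N])) (g' n @ concat (map g' [Suc n..<N]))"
    by (intro agree_appendD(2)[OF *]) (simp only:)
  then show ?thesis by (rule agree_prefixD)
qed

lemma agree_same_length: "agree xs ys \<Longrightarrow> length xs = length ys \<Longrightarrow> xs = ys"
  by (auto simp: agree_def intro: nth_equalityI)

text \<open>Known block lengths make concatenation injective. This splits a generation of a tree
  into the generations of the children of its root.\<close>

lemma map_eq_of_concat_map_eq:
  assumes "length us = length us'" and "concat (map g us) = concat (map g us')"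
    and "map (\<lambda>u. length (g u)) us = map (\<lambda>u. length (g u)) us'"
  shows "map g us = map g us'"
  using assms by (induction us us' rule: list_induct2) auto

text \<open>The common pattern of types tells from which one-type sublist the next entry is taken,
  so the mixed list can be reassembled.\<close>

lemma map_eq_of_filter_eq:
  assumes "length ks = length ks'" and "map rtype ks = map rtype ks'"
    and "\<And>i. map g (filter (\<lambda>s. rtype s = i) ks) = map g (filter (\<lambda>s. rtype s = i) ks')"
  shows "map g ks = map g ks'"
  using assms
proof (induction ks ks' rule: list_induct2)
  case (Cons k ks k' ks')
  have "g k = g k'" using Cons.prems(2)[of "rtype k"] Cons.prems(1) by simp
  moreover have "map g ks = map g ks'"
  proof (rule Cons.IH)
    show "map rtype ks = map rtype ks'" using Cons.prems(1) by simp
    fix i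
    show "map g (filter (\<lambda>s. rtype s = i) ks) = map g (filter (\<lambda>s. rtype s = i) ks')"
      using Cons.prems(2)[of i] Cons.prems(1) by (auto split: if_splits)
  qed
  ultimately show ?case by simp
qed simp

section \<open>Generations and breadth first order\<close>

lemma size_kid_less: "s \<in> set (kids t) \<Longrightarrow> size s < size t"
  by (cases t) (simp add: less_Suc_eq_le size_list_estimation')

lemma wf_tree_iff: "wf_tree t \<longleftrightarrow> sorted (map rtype (kids t)) \<and> (\<forall>s\<in>set (kids t). wf_tree s)"
  by (cases t) simp

lemma level_empty: "size t \<le> n \<Longrightarrow> level n t = []"
proof (induction n arbitrary: t)
  case 0
  then show ?case by (cases t) simp
next
  case (Suc n)
  then have "size s \<le> n" if "s \<in> set (kids t)" for s
    using size_kid_less[OF that] by simp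
  then show ?case using Suc.IH by auto
qed

lemma ilevel_empty: "size t \<le> n \<Longrightarrow> ilevel i n t = []"
proof (induction n arbitrary: t)
  case 0
  then show ?case by (cases t) simp
next
  case (Suc n)
  then have "size s \<le> n" if "s \<in> set (kids t)" for s
    using size_kid_less[OF that] by simp
  then show ?case using Suc.IH by auto
qed

lemma concat_upt_extend:
  assumes "\<And>n. M \<le> n \<Longrightarrow> g n = []" and "M \<le> N"
  shows "concat (map g [0..<N]) = concat (map g [0..<M])"
proof -
  have "[0..<N] = [0..<M] @ [M..<N]" using assms(2) upt_add_eq_append[of 0 M "N - M"] by simp
  then show ?thesis using assms(1) by simp
qed

text \<open>Generations from \<open>size t\<close> on are empty, so the upper end of the range is
  free. With \<open>ibfs_extend\<close> and \<open>sub_roots_extend\<close>, this lets two trees of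
  different sizes be read over a common range.\<close>

lemma bfs_extend: "size t \<le> N \<Longrightarrow> bfs t = concat (map (\<lambda>n. level n t) [0..<N])"
  unfolding bfs_def
  using concat_upt_extend[of "size t" "\<lambda>n. level n t" N]
    concat_upt_extend[of "size t" "\<lambda>n. level n t" "Suc (size t)"]
  by (simp add: level_empty del: upt_Suc)

lemma ibfs_extend: "size t \<le> N \<Longrightarrow> ibfs i t = concat (map (\<lambda>n. ilevel i n t) [0..<N])"
  unfolding ibfs_def
  using concat_upt_extend[of "size t" "\<lambda>n. ilevel i n t" N]
    concat_upt_extend[of "size t" "\<lambda>n. ilevel i n t" "Suc (size t)"]
  by (simp add: ilevel_empty del: upt_Suc)

lemma concat_map_concat:
  "concat (map g (concat xss)) = concat (map (\<lambda>xs. concat (map g xs)) xss)"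
  by (induction xss) auto

text \<open>\<open>level\<close> unfolds at the root; passing from one generation to the next needs
  the unfolding at the lowest generation.\<close>

lemma level_Suc_right: "level (Suc n) t = concat (map kids (level n t))"
proof (induction n arbitrary: t)
  case (Suc n)
  have "level (Suc (Suc n)) t = concat (map (level (Suc n)) (kids t))"
    by (simp only: level.simps(2)[of "Suc n"])
  also have "\<dots> = concat (map kids (level (Suc n) t))"
    unfolding level.simps(2)[of n t] concat_map_concat map_map comp_def
    by (intro arg_cong[where f = concat] map_cong refl Suc.IH)
  finally show ?case .
qed (simp add: level.simps(1)[abs_def] map_ident)

lemma ilevel_Suc_right:
  "ilevel i (Suc n) t = concat (map (\<lambda>u. filter (\<lambda>s. rtype s = i) (kids u)) (ilevel i n t))"
proof (induction n arbitrary: t)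
  case (Suc n)
  have "ilevel i (Suc (Suc n)) t =
      concat (map (\<lambda>s. ilevel i (Suc n) s) (filter (\<lambda>s. rtype s = i) (kids t)))"
    by (simp only: ilevel.simps(2)[of i "Suc n"])
  also have "\<dots> = concat (map (\<lambda>u. filter (\<lambda>s. rtype s = i) (kids u)) (ilevel i (Suc n) t))"
    unfolding ilevel.simps(2)[of i n t] concat_map_concat map_map comp_def
    by (intro arg_cong[where f = concat] map_cong refl Suc.IH)
  finally show ?case .
qed (simp add: ilevel.simps(1)[abs_def] map_ident)

text \<open>The offspring vectors of one generation give the size of the next. This makes the code
  of a one-type subtree self-delimiting.\<close>

lemma length_ilevel_Suc:
  "length (ilevel i (Suc n) t) = (\<Sum>q\<leftarrow>map offspring (ilevel i n t). q i)"
  by (simp only: ilevel_Suc_right)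
    (simp add: length_concat comp_def offspring_def)

text \<open>Well-formedness enters here: children are sorted by type, so the numbers of children of
  each type fix their order.\<close>

lemma rtype_kids_eq:
  assumes "wf_tree t" "wf_tree t'" "offspring t = offspring t'"
  shows "map rtype (kids t) = map rtype (kids t')"
proof -
  have "count (mset (map rtype ks)) j = length (filter (\<lambda>s. rtype s = j) ks)" for ks :: "'a ttree list" and j
    by (induction ks) auto
  then have "mset (map rtype (kids t)) = mset (map rtype (kids t'))"
    using assms(3) by (intro multiset_eqI) (simp add: offspring_def fun_eq_iff)
  then show ?thesis
    using assms(1,2) using wf_tree_iff[of t] wf_tree_iff[of t'] properties_for_sort[of "map rtype (kids t)" "map rtype (kids t')"]
      sorted_sort_id[of "map rtype (kids t')"] by simp
qed

text \<open>The subtree of the root's own type, with the children of other types kept as leaves, so that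
  every vertex of that subtree retains its offspring vector.\<close>

fun icut :: "'t ttree \<Rightarrow> 't ttree" where
  "icut (Node a ts) = Node a (map (\<lambda>s. if rtype s = a then icut s else Node (rtype s) []) ts)"

lemma rtype_icut [simp]: "rtype (icut t) = rtype t"
  by (cases t) simp

lemma kids_icut:
  "kids (icut t) = map (\<lambda>s. if rtype s = rtype t then icut s else Node (rtype s) []) (kids t)"
  by (cases t) simp

lemma icut_eqD:
  assumes "icut t = icut t'"
  shows "rtype t = rtype t'" and "map rtype (kids t) = map rtype (kids t')"
    and "map icut (filter (\<lambda>s. rtype s = rtype t) (kids t)) =
         map icut (filter (\<lambda>s. rtype s = rtype t) (kids t'))"
proof -
  show 1: "rtype t = rtype t'" using assms by (metis rtype_icut)
  have rt: "map rtype (kids t) = map rtype (kids (icut t))" for t :: "'a ttree"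
    by (simp add: kids_icut comp_def if_distrib cong: if_cong)
  show "map rtype (kids t) = map rtype (kids t')"
    using rt assms by metis
  have "map icut (filter (\<lambda>s. rtype s = rtype t) (kids t)) = filter (\<lambda>s. rtype s = rtype t) (kids (icut t))"
    for t :: "'a ttree"
  proof -
    have "map icut (filter (\<lambda>s. rtype s = a) ks) = filter (\<lambda>s. rtype s = a)
        (map (\<lambda>s. if rtype s = a then icut s else Node (rtype s) []) ks)" for ks :: "'a ttree list" and a
      by (induction ks) auto
    then show ?thesis by (simp only: kids_icut)
  qed
  then show "map icut (filter (\<lambda>s. rtype s = rtype t) (kids t)) =
         map icut (filter (\<lambda>s. rtype s = rtype t) (kids t'))"
    using assms 1 by metis
qed

text \<open>Induction on the tree: generation \<open>n + 1\<close> is the concatenation of the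
  generations \<open>n\<close> below the children of type \<open>i\<close>, and has to be split
  child by child. Children of other types are leaves of the cut tree, fixed by the offspring vector
  of the root.\<close>

lemma icut_eqI:
  assumes "wf_tree t" "wf_tree t'" "rtype t = i" "rtype t' = i"
    and "\<And>n. map offspring (ilevel i n t) = map offspring (ilevel i n t')"
  shows "icut t = icut t'"
  using assms
proof (induction t arbitrary: t')
  case (Node a ts)
  obtain ts' where t': "t' = Node i ts'" using Node.prems(4) by (cases t') auto
  have a: "a = i" using Node.prems(3) by simp
  have ty: "map rtype ts = map rtype ts'"
    using rtype_kids_eq[OF Node.prems(1,2)] Node.prems(5)[of 0] t' by simp
  define fs fs' where "fs = filter (\<lambda>s. rtype s = i) ts" and "fs' = filter (\<lambda>s. rtype s = i) ts'"
  have len: "length fs = length fs'"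
  proof -
    have "length fs = length (filter (\<lambda>x. x = i) (map rtype ts))" "length fs' = length (filter (\<lambda>x. x = i) (map rtype ts'))"
      by (simp_all add: fs_def fs'_def filter_map comp_def)
    then show ?thesis using ty by simp
  qed
  let ?g = "\<lambda>n s. map offspring (ilevel i n s)"
  have conc: "concat (map (?g n) fs) = concat (map (?g n) fs')" for n
    using Node.prems(5)[of "Suc n"] by (simp add: t' fs_def fs'_def map_concat comp_def)
  \<comment> \<open>Once generation \<open>n\<close> below each child is known, so is the length of
    each block of generation \<open>n + 1\<close>.\<close>
  have comp: "map (?g n) fs = map (?g n) fs'" for n
  proof (induction n)
    case 0
    show ?case
      by (rule map_eq_of_concat_map_eq[OF len conc]) (use len in \<open>simp add: map_replicate_const\<close>)
  next
    case (Suc n)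
    have "map (\<lambda>s. \<Sum>q\<leftarrow>?g n s. q i) fs = map (\<lambda>s. \<Sum>q\<leftarrow>?g n s. q i) fs'"
      using arg_cong[OF Suc, of "map (\<lambda>l. \<Sum>q\<leftarrow>l. q i)"] by (simp only: map_map comp_def)
    then show ?case
      by (intro map_eq_of_concat_map_eq[OF len conc]) (simp only: length_map length_ilevel_Suc)
  qed
  have "map icut fs = map icut fs'"
  proof (rule nth_equalityI)
    fix k assume k: "k < length (map icut fs)"
    have 1: "fs ! k \<in> set ts" "rtype (fs ! k) = i" "fs' ! k \<in> set ts'" "rtype (fs' ! k) = i"
      using k len nth_mem[of k fs] nth_mem[of k fs'] by (auto simp: fs_def fs'_def)
    have "icut (fs ! k) = icut (fs' ! k)"
    proof (rule Node.IH)
      fix n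
      show "map offspring (ilevel i n (fs ! k)) = map offspring (ilevel i n (fs' ! k))"
        using arg_cong[OF comp[of n], of "\<lambda>l. l ! k"] k len by simp
    qed (use 1 Node.prems t' in auto)
    then show "map icut fs ! k = map icut fs' ! k" using k len by simp
  qed (use len in simp)
  with ty have "map (\<lambda>s. if rtype s = i then icut s else Node (rtype s) []) ts =
    map (\<lambda>s. if rtype s = i then icut s else Node (rtype s) []) ts'"
    unfolding fs_def fs'_def
  proof (induction ts arbitrary: ts')
    case (Cons s ts)
    then obtain s' ts'' where "ts' = s' # ts''" by (cases ts') auto
    then show ?case using Cons by (auto split: if_splits)
  qed simp
  then show ?case using t' a by simp
qed

definition ioffspring :: "'t \<Rightarrow> 't ttree \<Rightarrow> ('t \<Rightarrow> nat) list" where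
  "ioffspring i t = map offspring (ibfs i t)"

text \<open>Strong induction on the generation: equal earlier generations put generation
  \<open>n\<close> at the same position of both lists and give it the same length, so agreement
  there is equality.\<close>

lemma ilevel_eq_of_agree:
  assumes "rtype t = i" "rtype t' = i" "agree (ioffspring i t) (ioffspring i t')"
  shows "map offspring (ilevel i n t) = map offspring (ilevel i n t')"
proof (induction n rule: less_induct)
  case (less n)
  \<comment> \<open>Larger than \<open>n\<close> and than both sizes: one range exhausts both
    subtrees and contains generation \<open>n\<close>.\<close>
  define N where "N = Suc (n + size t + size t')"
  let ?g = "\<lambda>t n. map offspring (ilevel i n t)"
  have "ioffspring i t = concat (map (?g t) [0..<N])" "ioffspring i t' = concat (map (?g t') [0..<N])"
    by (simp_all add: ioffspring_def ibfs_extend[of _ N] N_def map_concat comp_def del: upt_Suc)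
  then have "agree (concat (map (?g t) [0..<N])) (concat (map (?g t') [0..<N]))"
    using assms by simp
  from agree_concat_step[OF this less] have "agree (?g t n) (?g t' n)"
    by (simp add: N_def)
  moreover have "length (?g t n) = length (?g t' n)"
  proof (cases n)
    case (Suc m)
    then show ?thesis using less[of m] by (simp only: length_map length_ilevel_Suc)
  qed simp
  ultimately show ?case by (rule agree_same_length)
qed

lemma ioffspring_eqI:
  assumes "\<And>n. map offspring (ilevel i n t) = map offspring (ilevel i n t')"
  shows "ioffspring i t = ioffspring i t'"
proof -
  let ?N = "size t + size t'"
  have "ioffspring i t = concat (map (\<lambda>n. map offspring (ilevel i n t)) [0..<?N])"
    "ioffspring i t' = concat (map (\<lambda>n. map offspring (ilevel i n t')) [0..<?N])"
    by (simp_all add: ioffspring_def ibfs_extend[of _ ?N] map_concat comp_def)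
  then show ?thesis using assms by simp
qed

text \<open>The code of the first subtree is self-delimiting: agreement makes the two first codes
  equal, in particular equally long, after which the remaining codes agree too.\<close>

lemma icut_list_eq_of_agree:
  assumes "length us = length us'" and "\<forall>u\<in>set us \<union> set us'. wf_tree u \<and> rtype u = i"
    and "agree (concat (map (ioffspring i) us)) (concat (map (ioffspring i) us'))"
  shows "map icut us = map icut us' \<and> map (ioffspring i) us = map (ioffspring i) us'"
  using assms
proof (induction us us' rule: list_induct2)
  case (Cons u us u' us')
  have ag: "agree (ioffspring i u @ concat (map (ioffspring i) us)) (ioffspring i u' @ concat (map (ioffspring i) us'))"
    using Cons.prems(2) by simp
  have "agree (ioffspring i u) (ioffspring i u')"
    using ag by (rule agree_prefixD)
  then have eq: "map offspring (ilevel i n u) = map offspring (ilevel i n u')" for n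
    using Cons.prems(1) by (intro ilevel_eq_of_agree) auto
  have "icut u = icut u'"
    using Cons.prems(1) eq by (intro icut_eqI[where i = i]) auto
  moreover have *: "ioffspring i u = ioffspring i u'"
    by (rule ioffspring_eqI) (rule eq)
  moreover have "agree (concat (map (ioffspring i) us)) (concat (map (ioffspring i) us'))"
    using ag by (rule agree_appendD(2)) (simp add: *)
  ultimately show ?case using Cons by auto
qed simp

section \<open>Roots of one-type subtrees, by generation\<close>

definition foreign_kids :: "'t \<Rightarrow> 't ttree \<Rightarrow> 't ttree list" where
  "foreign_kids i u = (if rtype u = i then [] else filter (\<lambda>s. rtype s = i) (kids u))"

text \<open>Breadth first order lists the parents by generation, so this cuts
  \<open>sub_roots\<close> into blocks; the root of the tree, which has no parent, forms block
  0.\<close>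

definition level_roots :: "'t \<Rightarrow> 't ttree \<Rightarrow> nat \<Rightarrow> 't ttree list" where
  "level_roots i t n = (case n of 0 \<Rightarrow> if rtype t = i then [t] else []
     | Suc m \<Rightarrow> concat (map (foreign_kids i) (level m t)))"

lemma sub_roots_extend:
  assumes "size t < N"
  shows "sub_roots i t = concat (map (level_roots i t) [0..<N])"
proof -
  obtain M where M: "N = Suc M" using assms by (cases N) auto
  have *: "[0..<N] = 0 # map Suc [0..<M]" unfolding M map_Suc_upt by (rule upt_conv_Cons) simp
  have "bfs t = concat (map (\<lambda>n. level n t) [0..<M])"
    using assms M by (intro bfs_extend) simp
  moreover have "sub_roots i t = (if rtype t = i then [t] else []) @ concat (map (foreign_kids i) (bfs t))"
    by (simp add: sub_roots_def foreign_kids_def[abs_def])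
  ultimately show ?thesis unfolding *
    by (simp add: level_roots_def concat_map_concat comp_def)
qed

definition code :: "'t \<Rightarrow> 't ttree \<Rightarrow> ('t \<Rightarrow> nat) list" where
  "code i t = map offspring (type_vertices i t)"

lemma code_extend:
  assumes "size t < N"
  shows "code i t = concat (map (\<lambda>n. concat (map (ioffspring i) (level_roots i t n))) [0..<N])"
proof -
  have "code i t = concat (map (ioffspring i) (sub_roots i t))"
    by (simp add: code_def type_vertices_def map_concat comp_def ioffspring_def[abs_def])
  then show ?thesis by (simp add: sub_roots_extend[OF assms] concat_map_concat comp_def)
qed

lemma wf_level: "wf_tree t \<Longrightarrow> u \<in> set (level n t) \<Longrightarrow> wf_tree u"
proof (induction n arbitrary: t)
  case (Suc n)
  then show ?case using wf_tree_iff[of t] by auto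
qed simp

lemma level_roots_wf:
  assumes "wf_tree t" "u \<in> set (level_roots i t n)"
  shows "wf_tree u \<and> rtype u = i"
proof (cases n)
  case 0
  then show ?thesis using assms by (auto simp: level_roots_def split: if_splits)
next
  case (Suc m)
  then obtain v where "v \<in> set (level m t)" "u \<in> set (kids v)" "rtype u = i"
    using assms(2) by (auto simp: level_roots_def foreign_kids_def split: if_splits)
  then show ?thesis using wf_level[OF assms(1)] wf_tree_iff by blast
qed

text \<open>A child has either the type of its parent, and then its cut tree is part of the
  parent's, or another type, and then it is among the \<open>foreign_kids\<close>. The cut tree of
  the parent also shows the types of all children, so the two kinds can be interleaved.\<close>

lemma icut_kids_eq:
  assumes "map icut us = map icut us'"
    and "\<And>i. map icut (concat (map (foreign_kids i) us)) = map icut (concat (map (foreign_kids i) us'))"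
  shows "map icut (concat (map kids us)) = map icut (concat (map kids us'))"
proof -
  have "length us = length us'" using assms(1) by (metis length_map)
  then show ?thesis using assms
  proof (induction us us' rule: list_induct2)
    case (Cons u us u' us')
    have u: "icut u = icut u'" using Cons.prems(1) by simp
    note D = icut_eqD[OF u]
    have len: "length (foreign_kids i u) = length (foreign_kids i u')" for i
    proof -
      have lf: "length (filter (\<lambda>s. rtype s = i) ks) = length (filter (\<lambda>a. a = i) (map rtype ks))"
        for ks :: "'a ttree list"
        by (simp add: filter_map comp_def)
      show ?thesis by (simp only: foreign_kids_def lf D(1,2) if_distrib[of length] list.size(3))
    qed
    have *: "map icut (foreign_kids i u) @ map icut (concat (map (foreign_kids i) us)) =
        map icut (foreign_kids i u') @ map icut (concat (map (foreign_kids i) us'))" for i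
      using Cons.prems(2)[of i] by simp
    have 1: "map icut (foreign_kids i u) = map icut (foreign_kids i u')"
      "map icut (concat (map (foreign_kids i) us)) = map icut (concat (map (foreign_kids i) us'))" for i
      using iffD1[OF append_eq_append_conv[OF disjI1] *[of i]] len[of i] by simp_all
    have "map icut (kids u) = map icut (kids u')"
    proof (rule map_eq_of_filter_eq)
      show "map rtype (kids u) = map rtype (kids u')" by fact
      then show "length (kids u) = length (kids u')" by (metis length_map)
      fix i
      show "map icut (filter (\<lambda>s. rtype s = i) (kids u)) = map icut (filter (\<lambda>s. rtype s = i) (kids u'))"
        using 1(1)[of i] D(1,3) by (cases "rtype u = i") (auto simp: foreign_kids_def)
    qed
    moreover have "map icut (concat (map kids us)) = map icut (concat (map kids us'))"
      using Cons.prems(1) 1(2) by (intro Cons.IH) auto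
    ultimately show ?case by simp
  qed simp
qed

lemma length_level_Suc:
  "length (level (Suc n) t) = (\<Sum>u\<leftarrow>map icut (level n t). length (kids u))"
  by (simp only: level_Suc_right) (simp add: length_concat comp_def kids_icut)

text \<open>As in \<open>icut_eqI\<close>, a generation is split among the children of the root; the
  number of children of a vertex is still visible in its cut tree.\<close>

lemma tree_eq_of_icut_levels_eq:
  assumes "\<And>n. map icut (level n t) = map icut (level n t')"
  shows "t = t'"
  using assms
proof (induction t arbitrary: t')
  case (Node a ts)
  have c: "icut (Node a ts) = icut t'" using Node.prems[of 0] by simp
  obtain ts' where t': "t' = Node a ts'" using icut_eqD(1)[OF c] by (cases t') auto
  have len: "length ts = length ts'"
    using arg_cong[OF icut_eqD(2)[OF c], of length] t' by simp
  let ?g = "\<lambda>n s. map icut (level n s)"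
  have conc: "concat (map (?g n) ts) = concat (map (?g n) ts')" for n
    using Node.prems[of "Suc n"] by (simp add: t' map_concat comp_def)
  have comp: "map (?g n) ts = map (?g n) ts'" for n
  proof (induction n)
    case 0
    show ?case
      by (rule map_eq_of_concat_map_eq[OF len conc]) (use len in \<open>simp add: map_replicate_const\<close>)
  next
    case (Suc n)
    have "map (\<lambda>s. \<Sum>u\<leftarrow>?g n s. length (kids u)) ts = map (\<lambda>s. \<Sum>u\<leftarrow>?g n s. length (kids u)) ts'"
      using arg_cong[OF Suc, of "map (\<lambda>l. \<Sum>u\<leftarrow>l. length (kids u))"] by (simp only: map_map comp_def)
    then show ?case
      by (intro map_eq_of_concat_map_eq[OF len conc]) (simp only: length_map length_level_Suc)
  qed
  have "ts = ts'"
  proof (rule nth_equalityI[OF len])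
    fix k assume k: "k < length ts"
    show "ts ! k = ts' ! k"
    proof (rule Node.IH)
      fix n show "map icut (level n (ts ! k)) = map icut (level n (ts' ! k))"
        using arg_cong[OF comp[of n], of "\<lambda>l. l ! k"] k len by simp
    qed (use k in simp)
  qed
  then show ?case using t' by simp
qed

text \<open>The two halves of the induction hypothesis feed each other: the cut trees of the
  previous generation give the number of subtree roots in generation \<open>n\<close>, and equal
  earlier blocks fix the position where the codes of these subtrees start.\<close>

lemma tree_eq_of_codes_agree:
  assumes wf: "wf_tree t" "wf_tree t'" and rt: "rtype t = rtype t'"
    and ag: "\<And>i. agree (code i t) (code i t')"
  shows "t = t'"
proof (rule tree_eq_of_icut_levels_eq)
  let ?ch = "\<lambda>i t n. concat (map (ioffspring i) (level_roots i t n))"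
  fix n
  have "map icut (level n t) = map icut (level n t') \<and> (\<forall>i. ?ch i t n = ?ch i t' n)"
  proof (induction n rule: less_induct)
    case (less n)
    define N where "N = Suc (n + size t + size t')"
    have ag': "agree (?ch i t n) (?ch i t' n)" for i
    proof (rule agree_concat_step)
      show "agree (concat (map (?ch i t) [0..<N])) (concat (map (?ch i t') [0..<N]))"
        using ag[of i] code_extend[of t N i] code_extend[of t' N i] by (simp add: N_def del: upt_Suc)
    qed (use less in \<open>auto simp: N_def\<close>)
    have roots: "map icut (level_roots i t n) = map icut (level_roots i t' n) \<and>
        map (ioffspring i) (level_roots i t n) = map (ioffspring i) (level_roots i t' n)"
      if "length (level_roots i t n) = length (level_roots i t' n)" for i
      by (rule icut_list_eq_of_agree[OF that _ ag']) (use level_roots_wf wf in blast)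
    \<comment> \<open>New roots are counted in the cut trees one generation earlier, where children
      of other types survive as leaves.\<close>
    have len: "length (level_roots i t n) = length (level_roots i t' n)" for i
    proof (cases n)
      case 0
      then show ?thesis using rt by (simp add: level_roots_def)
    next
      case (Suc m)
      have len_fk: "length (foreign_kids i u) = (if rtype (icut u) = i then 0
          else length (filter (\<lambda>s. rtype s = i) (kids (icut u))))" for u :: "'a ttree"
        by (auto simp: foreign_kids_def kids_icut filter_map comp_def
            intro!: arg_cong[where f = length] filter_cong)
      have lr: "length (level_roots i t n) = (\<Sum>u\<leftarrow>map icut (level m t). if rtype u = i then 0
          else length (filter (\<lambda>s. rtype s = i) (kids u)))" for t :: "'a ttree"
        using Suc by (simp add: level_roots_def length_concat comp_def len_fk)
      have "map icut (level m t) = map icut (level m t')" using less[of m] Suc by simp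
      then show ?thesis by (simp only: lr)
    qed
    have "map icut (level n t) = map icut (level n t')"
    proof (cases n)
      case 0
      then show ?thesis using roots[OF len, of "rtype t"] rt by (simp add: level_roots_def)
    next
      case (Suc m)
      have "map icut (concat (map kids (level m t))) = map icut (concat (map kids (level m t')))"
      proof (rule icut_kids_eq)
        show "map icut (level m t) = map icut (level m t')" using less[of m] Suc by simp
        fix i
        show "map icut (concat (map (foreign_kids i) (level m t))) =
            map icut (concat (map (foreign_kids i) (level m t')))"
          using roots[OF len, of i] Suc by (simp add: level_roots_def)
      qed
      then show ?thesis by (simp only: Suc level_Suc_right)
    qed
    moreover have "\<forall>i. ?ch i t n = ?ch i t' n" by (simp add: roots[OF len])
    ultimately show ?case ..
  qed
  then show "map icut (level n t) = map icut (level n t')" ..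
qed

lemma forest_eq_of_codes_agree:
  assumes "length ts = length ts'" "map rtype ts = map rtype ts'"
    and "\<forall>t\<in>set ts \<union> set ts'. wf_tree t"
    and "\<And>i. agree (concat (map (code i) ts)) (concat (map (code i) ts'))"
  shows "ts = ts'"
  using assms
proof (induction ts ts' rule: list_induct2)
  case (Cons t ts t' ts')
  have ag: "agree (code i t @ concat (map (code i) ts)) (code i t' @ concat (map (code i) ts'))" for i
    using Cons.prems(3)[of i] by simp
  have t: "t = t'"
  proof (rule tree_eq_of_codes_agree)
    show "agree (code i t) (code i t')" for i
      using ag by (rule agree_prefixD)
  qed (use Cons.prems in auto)
  moreover have "ts = ts'"
  proof (rule Cons.IH)
    show "agree (concat (map (code i) ts)) (concat (map (code i) ts'))" for i
      using ag by (rule agree_appendD(2)) (simp add: t)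
  qed (use Cons.prems in auto)
  ultimately show ?case by simp
qed simp

section \<open>Counting vertices by type\<close>

text \<open>Weights and increments are products and sums over vertices, independent of the order.
  Multisets of occurrences make the traversal of the tree comparable with the traversals by
  type.\<close>

fun vertices :: "'t ttree \<Rightarrow> 't ttree multiset" where
  "vertices (Node a ts) = {#Node a ts#} + (\<Sum>s\<leftarrow>ts. vertices s)"

fun ivertices :: "'t \<Rightarrow> 't ttree \<Rightarrow> 't ttree multiset" where
  "ivertices i (Node a ts) = {#Node a ts#} + (\<Sum>s\<leftarrow>filter (\<lambda>s. rtype s = i) ts. ivertices i s)"

lemma sum_list_swap:
  fixes f :: "'a \<Rightarrow> 'b \<Rightarrow> 'c::comm_monoid_add"
  shows "(\<Sum>x\<leftarrow>xs. \<Sum>y\<leftarrow>ys. f x y) = (\<Sum>y\<leftarrow>ys. \<Sum>x\<leftarrow>xs. f x y)"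
  by (induction xs) (simp_all add: sum_list_addf)

lemma mset_concat_map: "mset (concat (map g xs)) = (\<Sum>x\<leftarrow>xs. mset (g x))"
  by (induction xs) auto

lemma upt_0_Suc: "[0..<Suc M] = 0 # map Suc [0..<M]"
  unfolding map_Suc_upt by (rule upt_conv_Cons) simp

lemma mset_levels: "size t \<le> N \<Longrightarrow> (\<Sum>n\<leftarrow>[0..<N]. mset (level n t)) = vertices t"
proof (induction t arbitrary: N)
  case (Node a ts)
  then obtain M where M: "N = Suc M" by (cases N) auto
  have le: "size s \<le> M" if "s \<in> set ts" for s
    using size_kid_less[of s "Node a ts"] that Node.prems M by simp
  have "(\<Sum>n\<leftarrow>[0..<N]. mset (level n (Node a ts))) =
      {#Node a ts#} + (\<Sum>n\<leftarrow>[0..<M]. \<Sum>s\<leftarrow>ts. mset (level n s))"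
    unfolding M upt_0_Suc by (simp add: comp_def mset_concat_map)
  also have "\<dots> = {#Node a ts#} + (\<Sum>s\<leftarrow>ts. \<Sum>n\<leftarrow>[0..<M]. mset (level n s))"
    by (simp only: sum_list_swap[of _ ts])
  also have "map (\<lambda>s. \<Sum>n\<leftarrow>[0..<M]. mset (level n s)) ts = map vertices ts"
    using Node.IH le by (intro map_cong) auto
  finally show ?case by simp
qed

lemma mset_bfs: "mset (bfs t) = vertices t"
  using mset_levels[of t "Suc (size t)"] unfolding bfs_def by (simp only: mset_concat_map le_SucI order_refl)

lemma mset_ilevels: "size t \<le> N \<Longrightarrow> (\<Sum>n\<leftarrow>[0..<N]. mset (ilevel i n t)) = ivertices i t"
proof (induction t arbitrary: N)
  case (Node a ts)
  then obtain M where M: "N = Suc M" by (cases N) auto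
  let ?fs = "filter (\<lambda>s. rtype s = i) ts"
  have le: "size s \<le> M" if "s \<in> set ts" for s
    using size_kid_less[of s "Node a ts"] that Node.prems M by simp
  have "(\<Sum>n\<leftarrow>[0..<N]. mset (ilevel i n (Node a ts))) =
      {#Node a ts#} + (\<Sum>n\<leftarrow>[0..<M]. \<Sum>s\<leftarrow>?fs. mset (ilevel i n s))"
    unfolding M upt_0_Suc by (simp add: comp_def mset_concat_map)
  also have "\<dots> = {#Node a ts#} + (\<Sum>s\<leftarrow>?fs. \<Sum>n\<leftarrow>[0..<M]. mset (ilevel i n s))"
    by (simp only: sum_list_swap[of _ ?fs])
  also have "map (\<lambda>s. \<Sum>n\<leftarrow>[0..<M]. mset (ilevel i n s)) ?fs = map (ivertices i) ?fs"
    using Node.IH le by (intro map_cong) auto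
  finally show ?case by simp
qed

lemma mset_ibfs: "mset (ibfs i t) = ivertices i t"
  using mset_ilevels[of t "Suc (size t)" i] unfolding ibfs_def by (simp only: mset_concat_map le_SucI order_refl)

lemma sum_mset_sum_list_image:
  "(\<Sum>x\<in>#(\<Sum>s\<leftarrow>ts. g s). f x) = (\<Sum>s\<leftarrow>ts. \<Sum>x\<in>#g s. f x)"
  by (induction ts) auto

lemma filter_mset_sum_list: "filter_mset P (\<Sum>s\<leftarrow>ts. g s) = (\<Sum>s\<leftarrow>ts. filter_mset P (g s))"
  by (induction ts) auto

lemma sum_list_filter_if: "(\<Sum>s\<leftarrow>filter P ts. g s) = (\<Sum>s\<leftarrow>ts. if P s then g s else {#})"
  by (induction ts) auto

text \<open>Each vertex of type \<open>i\<close> lies in exactly one subtree of type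
  \<open>i\<close>, whose root is the root of the tree or has a parent of another type. In the
  induction, the subtrees \<open>?R\<close> at the children of the root are absorbed by the root's
  own subtree if \<open>a = i\<close>, and otherwise start at its
  \<open>foreign_kids\<close>.\<close>

lemma filter_vertices:
  "(if rtype t = i then ivertices i t else {#}) +
     (\<Sum>u\<in>#vertices t. \<Sum>s\<leftarrow>foreign_kids i u. ivertices i s)
   = filter_mset (\<lambda>u. rtype u = i) (vertices t)"
proof (induction t)
  case (Node a ts)
  let ?F = "\<lambda>u. \<Sum>s\<leftarrow>foreign_kids i u. ivertices i s"
  let ?R = "\<Sum>s\<leftarrow>ts. if rtype s = i then ivertices i s else {#}"
  have "(\<Sum>s\<leftarrow>ts. filter_mset (\<lambda>u. rtype u = i) (vertices s)) =
      (\<Sum>s\<leftarrow>ts. (if rtype s = i then ivertices i s else {#}) + (\<Sum>u\<in>#vertices s. ?F u))"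
    by (intro arg_cong[where f = sum_list] map_cong refl Node.IH[symmetric])
  also have "\<dots> = ?R + (\<Sum>s\<leftarrow>ts. \<Sum>u\<in>#vertices s. ?F u)"
    by (rule sum_list_addf)
  finally have "filter_mset (\<lambda>u. rtype u = i) (vertices (Node a ts)) =
      (if a = i then {#Node a ts#} else {#}) + (?R + (\<Sum>s\<leftarrow>ts. \<Sum>u\<in>#vertices s. ?F u))"
    by (simp add: filter_mset_sum_list)
  moreover have "?F (Node a ts) = (if a = i then {#} else ?R)"
    by (simp add: foreign_kids_def sum_list_filter_if)
  ultimately show ?case
    by (simp add: sum_mset_sum_list_image sum_list_filter_if)
qed

lemma mset_type_vertices:
  "mset (type_vertices i t) = filter_mset (\<lambda>u. rtype u = i) (vertices t)"
proof -
  have "sub_roots i t = (if rtype t = i then [t] else []) @ concat (map (foreign_kids i) (bfs t))"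
    by (simp add: sub_roots_def foreign_kids_def[abs_def])
  then have "mset (type_vertices i t) = (if rtype t = i then ivertices i t else {#}) +
      (\<Sum>u\<leftarrow>bfs t. \<Sum>s\<leftarrow>foreign_kids i u. ivertices i s)"
    by (simp add: type_vertices_def mset_concat_map mset_ibfs concat_map_concat comp_def)
  also have "(\<Sum>u\<leftarrow>bfs t. \<Sum>s\<leftarrow>foreign_kids i u. ivertices i s) =
      (\<Sum>u\<in>#vertices t. \<Sum>s\<leftarrow>foreign_kids i u. ivertices i s)"
    unfolding mset_bfs[symmetric] mset_map[symmetric] sum_mset_sum_list ..
  finally show ?thesis by (simp only: filter_vertices)
qed

lemma rtype_type_vertices: "u \<in> set (type_vertices i t) \<Longrightarrow> rtype u = i"
  using arg_cong[OF mset_type_vertices[of i t], of set_mset] by auto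

lemma prod_mset_by_type:
  fixes g :: "('t::finite) ttree \<Rightarrow> real"
  shows "(\<Prod>u\<in>#M. g u) = (\<Prod>i\<in>UNIV. \<Prod>u\<in>#filter_mset (\<lambda>u. rtype u = i) M. g u)"
proof (induction M)
  case (add x M)
  have "(\<Prod>i\<in>UNIV. \<Prod>u\<in>#filter_mset (\<lambda>u. rtype u = i) (add_mset x M). g u) =
      (\<Prod>i\<in>UNIV. (if i = rtype x then g x else 1) * (\<Prod>u\<in>#filter_mset (\<lambda>u. rtype u = i) M. g u))"
    by (intro prod.cong) auto
  also have "\<dots> = g x * (\<Prod>u\<in>#M. g u)"
    by (simp add: prod.distrib prod.delta add)
  finally show ?case by simp
qed simp

lemma sum_mset_by_type:
  fixes g :: "('t::finite) ttree \<Rightarrow> int"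
  shows "(\<Sum>u\<in>#M. g u) = (\<Sum>i\<in>UNIV. \<Sum>u\<in>#filter_mset (\<lambda>u. rtype u = i) M. g u)"
proof (induction M)
  case (add x M)
  have "(\<Sum>i\<in>UNIV. \<Sum>u\<in>#filter_mset (\<lambda>u. rtype u = i) (add_mset x M). g u) =
      (\<Sum>i\<in>UNIV. (if i = rtype x then g x else 0) + (\<Sum>u\<in>#filter_mset (\<lambda>u. rtype u = i) M. g u))"
    by (intro sum.cong) auto
  also have "\<dots> = g x + (\<Sum>u\<in>#M. g u)"
    by (simp add: sum.distrib sum.delta add)
  finally show ?case by simp
qed simp

text \<open>Grouping the factors by type turns the weight into the probability that independent
  offspring vectors of the various types start with the code of \<open>t\<close>.\<close>

lemma gw_weight_code:
  fixes \<nu> :: "'t::{finite,linorder} \<Rightarrow> ('t \<Rightarrow> nat) pmf"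
  assumes "wf_tree t" "rtype t = i"
  shows "gw_weight \<nu> i t = (\<Prod>j\<in>UNIV. \<Prod>q\<leftarrow>code j t. pmf (\<nu> j) q)"
proof -
  let ?g = "\<lambda>u. pmf (\<nu> (rtype u)) (offspring u)"
  have "gw_weight \<nu> i t = (\<Prod>u\<leftarrow>bfs t. ?g u)" using assms by (simp add: gw_weight_def)
  also have "\<dots> = (\<Prod>u\<in>#vertices t. ?g u)"
    unfolding mset_bfs[symmetric] mset_map[symmetric] prod_mset_prod_list ..
  also have "\<dots> = (\<Prod>j\<in>UNIV. \<Prod>u\<in>#mset (type_vertices j t). ?g u)"
    unfolding mset_type_vertices by (rule prod_mset_by_type)
  also have "\<dots> = (\<Prod>j\<in>UNIV. \<Prod>u\<leftarrow>type_vertices j t. pmf (\<nu> j) (offspring u))"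
    unfolding mset_map[symmetric] prod_mset_prod_list
    by (intro prod.cong arg_cong[where f = prod_list] map_cong refl) (simp add: rtype_type_vertices)
  finally show ?thesis by (simp add: code_def comp_def)
qed

text \<open>Every vertex except the root is a child of exactly one vertex, so children and vertices
  of type \<open>j\<close> cancel up to the root.\<close>

lemma sum_type_vertices_offspring:
  fixes t :: "('t::finite) ttree"
  shows "(\<Sum>i\<in>UNIV. \<Sum>u\<leftarrow>type_vertices i t. int (offspring u j) - (if j = i then 1 else 0)) =
    - (if rtype t = j then 1 else 0)"
proof -
  let ?g = "\<lambda>u. int (offspring u j) - (if j = rtype u then 1 else 0)"
  have "(\<Sum>i\<in>UNIV. \<Sum>u\<leftarrow>type_vertices i t. int (offspring u j) - (if j = i then 1 else 0)) =
      (\<Sum>i\<in>UNIV. \<Sum>u\<leftarrow>type_vertices i t. ?g u)"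
    by (intro sum.cong arg_cong[where f = sum_list] map_cong refl) (simp add: rtype_type_vertices)
  also have "\<dots> = (\<Sum>i\<in>UNIV. \<Sum>u\<in>#filter_mset (\<lambda>u. rtype u = i) (vertices t). ?g u)"
    unfolding mset_type_vertices[symmetric] mset_map[symmetric] sum_mset_sum_list ..
  also have "\<dots> = (\<Sum>u\<in>#vertices t. ?g u)" by (rule sum_mset_by_type[symmetric])
  also have "\<dots> = - (if rtype t = j then 1 else 0)"
  proof (induction t)
    case (Node a ts)
    have "(\<Sum>s\<leftarrow>ts. \<Sum>u\<in>#vertices s. ?g u) = (\<Sum>s\<leftarrow>ts. - (if rtype s = j then 1 else 0))"
      by (intro arg_cong[where f = sum_list] map_cong refl Node.IH)
    also have "\<dots> = - int (offspring (Node a ts) j)"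
      unfolding offspring_def kids.simps by (induction ts) auto
    finally show ?case by (simp add: sum_mset_sum_list_image)
  qed
  finally show ?thesis .
qed

text \<open>The same cancellation inside one subtree of type \<open>i\<close>; the diagonal walk
  thus drops by one with each completed subtree.\<close>

lemma sum_ibfs_offspring: "(\<Sum>u\<leftarrow>ibfs i t. int (offspring u i) - 1) = - 1"
proof -
  have "(\<Sum>u\<leftarrow>ibfs i t. int (offspring u i) - 1) = (\<Sum>u\<in>#ivertices i t. int (offspring u i) - 1)"
    unfolding mset_ibfs[symmetric] mset_map[symmetric] sum_mset_sum_list ..
  also have "\<dots> = - 1"
  proof (induction t)
    case (Node a ts)
    let ?fs = "filter (\<lambda>s. rtype s = i) ts"
    have "(\<Sum>s\<leftarrow>?fs. \<Sum>u\<in>#ivertices i s. int (offspring u i) - 1) = (\<Sum>s\<leftarrow>?fs. - 1)"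
      using Node.IH by (intro arg_cong[where f = sum_list] map_cong refl) auto
    then show ?case by (simp add: sum_mset_sum_list_image sum_list_triv offspring_def)
  qed
  finally show ?thesis .
qed

lemma sum_list_concat_map:
  fixes g :: "'a \<Rightarrow> int"
  shows "(\<Sum>x\<leftarrow>concat (map h xs). g x) = (\<Sum>y\<leftarrow>xs. \<Sum>x\<leftarrow>h y. g x)"
  by (induction xs) auto

lemma sum_type_vertices_own_offspring:
  "(\<Sum>u\<leftarrow>type_vertices i t. int (offspring u i) - 1) = - int (length (sub_roots i t))"
  unfolding type_vertices_def sum_list_concat_map sum_ibfs_offspring
  by (simp add: sum_list_triv)

section \<open>Solutions of the coding system\<close>

lemma prefix_vertices_Suc:
  "prefix_vertices f i (Suc m) = prefix_vertices f i m @ type_vertices i (f m)"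
  by (simp add: prefix_vertices_def)

lemma prefix_vertices_mono:
  assumes "m \<le> m'"
  shows "\<exists>xs. prefix_vertices f i m' = prefix_vertices f i m @ xs"
  using assms by (induction m' rule: dec_induct) (auto simp: prefix_vertices_Suc)

text \<open>The lists \<open>prefix_vertices f i m\<close> extend one another, so any
  \<open>m\<close> that reaches index \<open>n\<close> can replace the least one.\<close>

lemma vertex_seq_nth:
  assumes "n < length (prefix_vertices f i m)"
  shows "vertex_seq f i n = prefix_vertices f i m ! n"
proof -
  let ?l = "LEAST m. n < length (prefix_vertices f i m)"
  have "n < length (prefix_vertices f i ?l)" by (rule LeastI) (rule assms)
  moreover have "?l \<le> m" by (rule Least_le) (rule assms)
  from prefix_vertices_mono[OF this, of f i]
  obtain xs where "prefix_vertices f i m = prefix_vertices f i ?l @ xs" ..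
  ultimately show ?thesis by (simp add: vertex_seq_def nth_append)
qed

lemma coding_walk_prefix:
  "coding_walk f i (length (prefix_vertices f i m)) j =
     (\<Sum>u\<leftarrow>prefix_vertices f i m. int (offspring u j) - (if j = i then 1 else 0))"
  unfolding coding_walk_def sum_list_sum_nth
  by (intro sum.cong) (auto simp: vertex_seq_nth[where m = m])

lemma coding_walk_Suc:
  "coding_walk f i (Suc n) j - coding_walk f i n j =
     int (offspring (vertex_seq f i n) j) - (if j = i then 1 else 0)"
  by (simp add: coding_walk_def)

text \<open>The cancellation in single trees, summed over the first \<open>r\<close> trees, leaves
  only their roots, counted by type.\<close>

lemma is_solution_prefix:
  fixes f :: "nat \<Rightarrow> ('t::finite) ttree"
  shows "is_solution (\<lambda>j. length (filter (\<lambda>k. rtype (f k) = j) [0..<r])) (coding_walk f)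
    (\<lambda>i. length (prefix_vertices f i r))"
  unfolding is_solution_def coding_walk_prefix
proof
  fix j
  show "int (length (filter (\<lambda>k. rtype (f k) = j) [0..<r])) +
    (\<Sum>i\<in>UNIV. \<Sum>u\<leftarrow>prefix_vertices f i r. int (offspring u j) - (if j = i then 1 else 0)) = 0"
  proof (induction r)
    case (Suc r)
    then show ?case
      using sum_type_vertices_offspring[where t = "f r" and j = j]
      by (simp add: prefix_vertices_Suc sum.distrib)
  qed (simp add: prefix_vertices_def)
qed

text \<open>The supersolutions are closed under componentwise minimum. The least one is a solution,
  because a strict inequality in coordinate \<open>j\<close> would survive a decrease of \<open>s j\<close> by one.\<close>

lemma exists_smallest_solution:
  fixes X :: "'t::finite \<Rightarrow> nat \<Rightarrow> 't \<Rightarrow> int"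
  assumes zero: "\<And>i j. X i 0 j = 0"
    and skip_free: "\<And>i n. X i n i - 1 \<le> X i (Suc n) i"
    and mono: "\<And>i j n. i \<noteq> j \<Longrightarrow> X i n j \<le> X i (Suc n) j"
    and sol: "is_solution r X s0"
  shows "\<exists>n. smallest_solution r X n"
proof -
  define super where "super s \<longleftrightarrow> (\<forall>j. int (r j) + (\<Sum>i\<in>UNIV. X i (s i) j) \<le> 0)" for s
  have mono': "X i m j \<le> X i n j" if "i \<noteq> j" "m \<le> n" for i j m n
    using that(2)
  proof (induction n rule: dec_induct)
    case (step n)
    then show ?case using mono[OF that(1), of n] by linarith
  qed simp
  have sol_super: "super s" if "is_solution r X s" for s
    using that by (simp add: super_def is_solution_def)
  have split_sum: "(\<Sum>i\<in>UNIV. X i (s i) j) = X j (s j) j + (\<Sum>i\<in>UNIV - {j}. X i (s i) j)" for s j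
    by (simp add: sum.remove[of UNIV j])
  have le_sum: "(\<Sum>i\<in>UNIV. X i (s i) j) \<le> (\<Sum>i\<in>UNIV. X i (s' i) j)"
    if "s \<le> s'" "X j (s j) j \<le> X j (s' j) j" for s s' j
    unfolding split_sum[of s] split_sum[of s']
    using that by (intro add_mono sum_mono) (auto simp: le_fun_def intro: mono')
  \<comment> \<open>In inequality \<open>j\<close>, compare with whichever of the two is smaller at
    \<open>j\<close>: the diagonal term is unchanged and the others can only decrease.\<close>
  have super_min: "super (\<lambda>i. min (s i) (s' i))" if "super s" "super s'" for s s'
    unfolding super_def
  proof
    fix j
    show "int (r j) + (\<Sum>i\<in>UNIV. X i (min (s i) (s' i)) j) \<le> 0"
    proof (cases "s j \<le> s' j")
      case True
      have "(\<Sum>i\<in>UNIV. X i (min (s i) (s' i)) j) \<le> (\<Sum>i\<in>UNIV. X i (s i) j)"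
        by (rule le_sum) (use True in \<open>auto simp: le_fun_def min_def\<close>)
      then show ?thesis using that(1)[unfolded super_def, rule_format, of j] by linarith
    next
      case False
      have "(\<Sum>i\<in>UNIV. X i (min (s i) (s' i)) j) \<le> (\<Sum>i\<in>UNIV. X i (s' i) j)"
        by (rule le_sum) (use False in \<open>auto simp: le_fun_def min_def\<close>)
      then show ?thesis using that(2)[unfolded super_def, rule_format, of j] by linarith
    qed
  qed
  \<comment> \<open>A supersolution of least coordinate sum lies below every other one: their
    minimum is a supersolution too and cannot have a smaller sum.\<close>
  obtain n where n: "super n" and least: "\<And>s. super s \<Longrightarrow> sum n UNIV \<le> sum s UNIV"
    using ex_has_least_nat[of super s0 "\<lambda>s. sum s UNIV"] sol_super[OF sol] by blast
  have le: "n i \<le> s i" if "super s" for s i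
  proof (rule ccontr)
    assume "\<not> n i \<le> s i"
    then have "sum (\<lambda>i. min (n i) (s i)) UNIV < sum n UNIV"
    proof (intro sum_strict_mono_ex1)
      show "\<exists>a\<in>UNIV. min (n a) (s a) < n a"
        using \<open>\<not> n i \<le> s i\<close> by (intro bexI[of _ i]) auto
    qed auto
    then show False using least[OF super_min[OF n that]] by simp
  qed
  have "is_solution r X n"
    unfolding is_solution_def
  proof (rule allI, rule ccontr)
    fix j assume neq: "int (r j) + (\<Sum>i\<in>UNIV. X i (n i) j) \<noteq> 0"
    then have lt: "int (r j) + (\<Sum>i\<in>UNIV. X i (n i) j) \<le> - 1"
      using n[unfolded super_def, rule_format, of j] by linarith
    \<comment> \<open>The off-diagonal terms are nonnegative and the diagonal walk starts at 0, so a
      strict inequality forces \<open>n j\<close> to be positive.\<close>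
    have ge0: "0 \<le> (\<Sum>i\<in>UNIV - {j}. X i (n i) j)"
      using mono'[of _ j 0] zero by (intro sum_nonneg) auto
    have "n j \<noteq> 0"
    proof
      assume "n j = 0"
      then show False using lt ge0 zero[of j j] unfolding split_sum[of n j] by simp
    qed
    then obtain m where m: "n j = Suc m" by (cases "n j") auto
    define s where "s = n(j := m)"
    have sn: "s \<le> n" by (simp add: s_def le_fun_def m)
    have "super s"
      unfolding super_def
    proof
      fix k
      show "int (r k) + (\<Sum>i\<in>UNIV. X i (s i) k) \<le> 0"
      proof (cases "k = j")
        case True
        have "(\<Sum>i\<in>UNIV - {j}. X i (s i) j) = (\<Sum>i\<in>UNIV - {j}. X i (n i) j)"
          by (intro sum.cong) (auto simp: s_def)
        then show ?thesis
          using lt skip_free[of j m] True unfolding split_sum by (simp add: s_def m)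
      next
        case False
        have "(\<Sum>i\<in>UNIV. X i (s i) k) \<le> (\<Sum>i\<in>UNIV. X i (n i) k)"
          by (rule le_sum[OF sn]) (use False in \<open>simp add: s_def\<close>)
        then show ?thesis using n[unfolded super_def, rule_format, of k] by linarith
      qed
    qed
    from le[OF this, of j] show False by (simp add: s_def m)
  qed
  then show ?thesis using le sol_super unfolding smallest_solution_def by blast
qed

lemma coding_walk_skip_free: "coding_walk f i (Suc n) i \<ge> coding_walk f i n i - 1"
  using coding_walk_Suc[of f i n i] by simp

lemma coding_walk_mono: "i \<noteq> j \<Longrightarrow> coding_walk f i n j \<le> coding_walk f i (Suc n) j"
  using coding_walk_Suc[of f i n j] by simp

text \<open>The witness counts the roots of the first \<open>r\<close> trees by type, so the claim
  holds for every single forest.\<close>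

lemma coding_system_solvable:
  fixes f :: "nat \<Rightarrow> ('t::finite) ttree"
  shows "\<exists>rv. (\<Sum>j\<in>UNIV. rv j) = r \<and> (\<exists>n. smallest_solution rv (coding_walk f) n)"
proof -
  define rv where "rv = (\<lambda>j. length (filter (\<lambda>k. rtype (f k) = j) [0..<r]))"
  have "(\<Sum>j\<in>UNIV. rv j) = r"
    unfolding rv_def
  proof (induction r)
    case (Suc r)
    have "(\<Sum>j\<in>UNIV. length (filter (\<lambda>k. rtype (f k) = j) [0..<Suc r])) =
      (\<Sum>j\<in>UNIV. length (filter (\<lambda>k. rtype (f k) = j) [0..<r]) + (if rtype (f r) = j then 1 else 0))"
      by (intro sum.cong) auto
    then show ?case using Suc by (simp add: sum.distrib)
  qed simp
  moreover have "\<exists>n. smallest_solution rv (coding_walk f) n"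
    unfolding rv_def
    by (rule exists_smallest_solution[OF _ _ _ is_solution_prefix])
      (simp_all add: coding_walk_def[of _ _ 0] coding_walk_skip_free coding_walk_mono)
  ultimately show ?thesis by blast
qed

section \<open>Infinite subforests\<close>

lemma liminf_int_eq_minus_infinity:
  fixes X :: "nat \<Rightarrow> int"
  assumes "\<And>B. \<exists>n. X n \<le> B"
  shows "liminf (\<lambda>n. ereal (real_of_int (X n))) = -\<infinity>"
proof (rule ccontr)
  assume "liminf (\<lambda>n. ereal (real_of_int (X n))) \<noteq> -\<infinity>"
  then have "-\<infinity> < liminf (\<lambda>n. ereal (real_of_int (X n)))" by simp
  then obtain b where "ereal b < liminf (\<lambda>n. ereal (real_of_int (X n)))"
    using ereal_dense2 by blast
  then have "\<forall>\<^sub>F n in sequentially. ereal b < ereal (real_of_int (X n))"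
    by (rule less_LiminfD)
  then obtain N where N: "\<And>n. n \<ge> N \<Longrightarrow> b < real_of_int (X n)"
    by (auto simp: eventually_sequentially)
  \<comment> \<open>Below \<open>b\<close>, which excludes the indices beyond \<open>N\<close>, and
    below all values up to \<open>N\<close>.\<close>
  obtain n where n: "X n \<le> min (\<lfloor>b\<rfloor>) (Min (X ` {..N})) - 1" using assms by blast
  show False
  proof (cases "n \<le> N")
    case True
    then have "Min (X ` {..N}) \<le> X n" by (intro Min_le) auto
    then show False using n by linarith
  next
    case False
    then show False using N[of n] n by linarith
  qed
qed

lemma type_vertices_nonempty_imp_sub_roots:
  "type_vertices i t \<noteq> [] \<Longrightarrow> sub_roots i t \<noteq> []"
  by (auto simp: type_vertices_def)

text \<open>Trees are finite, so infinitely many vertices of type \<open>i\<close> have to be spread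
  over infinitely many trees.\<close>

lemma subforest_infinite_iff:
  "subforest_infinite f i \<longleftrightarrow> (\<exists>\<^sub>\<infinity>k. type_vertices i (f k) \<noteq> [])"
proof
  assume inf: "subforest_infinite f i"
  show "\<exists>\<^sub>\<infinity>k. type_vertices i (f k) \<noteq> []"
    unfolding INFM_nat_le
  proof (rule allI, rule ccontr)
    fix m assume "\<not> (\<exists>k\<ge>m. type_vertices i (f k) \<noteq> [])"
    then have e: "type_vertices i (f k) = []" if "k \<ge> m" for k using that by blast
    have eq: "prefix_vertices f i (m + k) = prefix_vertices f i m" for k
      by (induction k) (simp_all add: prefix_vertices_Suc e)
    obtain m' where "length (prefix_vertices f i m) < length (prefix_vertices f i m')"
      using inf unfolding subforest_infinite_def by blast
    moreover obtain xs where "prefix_vertices f i (m + m') = prefix_vertices f i m' @ xs"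
      using prefix_vertices_mono[of m' "m + m'" f i] by auto
    ultimately show False using arg_cong[OF eq[of m'], of length] by simp
  qed
next
  assume inf: "\<exists>\<^sub>\<infinity>k. type_vertices i (f k) \<noteq> []"
  show "subforest_infinite f i"
    unfolding subforest_infinite_def
  proof
    fix n show "\<exists>m. n < length (prefix_vertices f i m)"
    proof (induction n)
      case 0
      obtain k where "type_vertices i (f k) \<noteq> []" using inf unfolding INFM_nat_le by blast
      then show ?case by (intro exI[of _ "Suc k"]) (simp add: prefix_vertices_Suc)
    next
      case (Suc n)
      then obtain m where m: "n < length (prefix_vertices f i m)" by blast
      obtain k where k: "k \<ge> m" "type_vertices i (f k) \<noteq> []" using inf unfolding INFM_nat_le by blast
      from prefix_vertices_mono[OF k(1), of f i]
      obtain xs where "prefix_vertices f i k = prefix_vertices f i m @ xs" ..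
      then show ?case using m k(2)
        by (intro exI[of _ "Suc k"]) (cases "type_vertices i (f k)"; simp add: prefix_vertices_Suc)
    qed
  qed
qed

text \<open>At the end of each tree the diagonal walk equals minus the number of subtrees of type
  \<open>i\<close> met so far, and infinitely many trees contribute to that number.\<close>

lemma liminf_coding_walk:
  assumes "subforest_infinite f i"
  shows "liminf (\<lambda>n. ereal (real_of_int (coding_walk f i n i))) = -\<infinity>"
proof (rule liminf_int_eq_minus_infinity)
  fix B :: int
  have walk: "coding_walk f i (length (prefix_vertices f i m)) i = - (\<Sum>k<m. int (length (sub_roots i (f k))))" for m
    unfolding coding_walk_prefix
    by (induction m) (simp_all add: prefix_vertices_Suc sum_type_vertices_own_offspring,
      simp add: prefix_vertices_def)
  have ex: "\<exists>m. int b \<le> (\<Sum>k<m. int (length (sub_roots i (f k))))" for b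
  proof (induction b)
    case (Suc b)
    then obtain m where m: "int b \<le> (\<Sum>k<m. int (length (sub_roots i (f k))))" by blast
    obtain k where k: "k \<ge> m" "type_vertices i (f k) \<noteq> []"
      using assms unfolding subforest_infinite_iff INFM_nat_le by blast
    have "(\<Sum>k<m. int (length (sub_roots i (f k)))) \<le> (\<Sum>l<k. int (length (sub_roots i (f l))))"
      using k(1) by (intro sum_mono2) auto
    moreover have "1 \<le> int (length (sub_roots i (f k)))"
      using type_vertices_nonempty_imp_sub_roots[OF k(2)] by (cases "sub_roots i (f k)") auto
    ultimately have "int (Suc b) \<le> (\<Sum>l<Suc k. int (length (sub_roots i (f l))))"
      using m by (simp only: sum.lessThan_Suc of_nat_Suc)
    then show ?case ..
  qed (intro exI[of _ 0], simp)
  from ex[of "nat (- B)"] obtain m where "int (nat (- B)) \<le> (\<Sum>k<m. int (length (sub_roots i (f k))))" by blast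
  then show "\<exists>n. coding_walk f i n i \<le> B"
    using walk[of m] by (intro exI[of _ "length (prefix_vertices f i m)"]) linarith
qed

section \<open>Arrays of offspring vectors\<close>

definition offspring_array :: "(nat \<Rightarrow> 't ttree) \<Rightarrow> 't \<times> nat \<Rightarrow> 't \<Rightarrow> nat" where
  "offspring_array f = (\<lambda>(i, n). offspring (vertex_seq f i n))"

definition codes_forest :: "('t \<times> nat \<Rightarrow> 't \<Rightarrow> nat) \<Rightarrow> 't ttree list \<Rightarrow> bool" where
  "codes_forest x ts \<longleftrightarrow> (\<forall>i n. n < length (concat (map (code i) ts)) \<longrightarrow>
     x (i, n) = concat (map (code i) ts) ! n)"

lemma codes_forest_unique:
  assumes "codes_forest x ts" "codes_forest x ts'" "length ts = length ts'"
    "map rtype ts = map rtype ts'" "\<forall>t\<in>set ts \<union> set ts'. wf_tree t"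
  shows "ts = ts'"
proof (rule forest_eq_of_codes_agree[OF assms(3,4,5)])
  show "agree (concat (map (code i) ts)) (concat (map (code i) ts'))" for i
    unfolding agree_def
  proof (intro allI impI)
    fix n assume "n < length (concat (map (code i) ts))" "n < length (concat (map (code i) ts'))"
    then show "concat (map (code i) ts) ! n = concat (map (code i) ts') ! n"
      using assms(1)[unfolded codes_forest_def, rule_format, of n i]
        assms(2)[unfolded codes_forest_def, rule_format, of n i] by (simp only:)
  qed
qed

lemma codes_forest_appendD: "codes_forest x (ts @ ts') \<Longrightarrow> codes_forest x ts"
  unfolding codes_forest_def
proof (intro allI impI)
  fix i n
  assume *: "\<forall>i n. n < length (concat (map (code i) (ts @ ts'))) \<longrightarrow> x (i, n) = concat (map (code i) (ts @ ts')) ! n"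
    and n: "n < length (concat (map (code i) ts))"
  have "x (i, n) = concat (map (code i) (ts @ ts')) ! n"
    by (rule *[rule_format]) (use n in simp)
  then show "x (i, n) = concat (map (code i) ts) ! n" using n by (simp add: nth_append)
qed

lemma concat_code_prefix:
  "concat (map (code i) (map f [0..<m])) = map offspring (prefix_vertices f i m)"
  by (simp add: code_def[abs_def] prefix_vertices_def map_concat comp_def)

lemma codes_forest_offspring_array: "codes_forest (offspring_array f) (map f [0..<m])"
  unfolding codes_forest_def concat_code_prefix
  by (simp add: offspring_array_def vertex_seq_nth[where m = m])

text \<open>Infinite subforests ensure that every entry of \<open>x\<close> is read within finitely
  many trees.\<close>

lemma offspring_array_eqI:
  assumes "\<And>i. subforest_infinite f i" "\<And>m. codes_forest x (map f [0..<m])"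
  shows "offspring_array f = x"
proof
  fix p :: "'a \<times> nat"
  obtain i n where p: "p = (i, n)" by (cases p)
  obtain m where m: "n < length (prefix_vertices f i m)"
    using assms(1) unfolding subforest_infinite_def by blast
  then show "offspring_array f p = x p"
    using assms(2)[of m] unfolding codes_forest_def concat_code_prefix p
    by (simp add: offspring_array_def vertex_seq_nth[where m = m])
qed

section \<open>Every type occurs infinitely often\<close>

lemma rtype_in_vertices: "type_vertices i t \<noteq> [] \<longleftrightarrow> (\<exists>u\<in>#vertices t. rtype u = i)"
proof -
  have "type_vertices i t \<noteq> [] \<longleftrightarrow> set_mset (mset (type_vertices i t)) \<noteq> {}" by simp
  then show ?thesis unfolding mset_type_vertices by auto
qed

lemma gw_weight_Node:
  assumes "sorted (map rtype ts)"
  shows "gw_weight \<nu> a (Node a ts) =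
    pmf (\<nu> a) (offspring (Node a ts)) * (\<Prod>s\<leftarrow>ts. gw_weight \<nu> (rtype s) s)"
proof (cases "\<forall>s\<in>set ts. wf_tree s")
  case True
  let ?g = "\<lambda>u. pmf (\<nu> (rtype u)) (offspring u)"
  have bfs: "(\<Prod>u\<leftarrow>bfs t. ?g u) = (\<Prod>u\<in>#vertices t. ?g u)" for t
    unfolding mset_bfs[symmetric] mset_map[symmetric] prod_mset_prod_list ..
  have "(\<Prod>u\<in>#(\<Sum>s\<leftarrow>ts. vertices s). ?g u) = (\<Prod>s\<leftarrow>ts. \<Prod>u\<in>#vertices s. ?g u)"
    by (induction ts) auto
  also have "\<dots> = (\<Prod>s\<leftarrow>ts. gw_weight \<nu> (rtype s) s)"
    using True by (intro arg_cong[where f = prod_list] map_cong refl) (simp add: gw_weight_def bfs)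
  finally show ?thesis using True assms by (simp add: gw_weight_def bfs)
next
  case False
  then obtain s where s: "s \<in> set ts" "\<not> wf_tree s" by blast
  then have "(\<Prod>s\<leftarrow>ts. gw_weight \<nu> (rtype s) s) = 0"
    by (simp add: prod_list_zero_iff gw_weight_def image_iff) force
  moreover have "gw_weight \<nu> a (Node a ts) = 0" using s by (auto simp: gw_weight_def)
  ultimately show ?thesis by simp
qed

lemma gw_weight_nonneg: "0 \<le> gw_weight \<nu> i t"
  unfolding gw_weight_def by (auto intro!: prod_list_nonneg)

text \<open>One step towards the root in \<open>exists_tree_with_type\<close>: under a new root of
  type \<open>a\<close>, the tree \<open>T j\<close> is hung at each child of type
  \<open>j\<close>.\<close>

lemma extend_tree:
  fixes \<nu> :: "'t::{finite,linorder} \<Rightarrow> ('t \<Rightarrow> nat) pmf"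
  assumes q: "pmf (\<nu> a) q > 0" and T: "\<And>j. gw_weight \<nu> j (T j) > 0"
  shows "\<exists>ts. gw_weight \<nu> a (Node a ts) > 0 \<and> (\<forall>j. q j > 0 \<longrightarrow> T j \<in> set ts)"
proof -
  have rT: "rtype (T j) = j" for j
    using T[of j] by (auto simp: gw_weight_def split: if_splits)
  \<comment> \<open>As there are finitely many types, \<open>q\<close> is the count function of a
    multiset; its sorted list gives the types of the children in admissible order.\<close>
  define L where "L = sorted_list_of_multiset (Abs_multiset q)"
  have cnt: "count (mset L) = q"
    by (simp add: L_def Abs_multiset_inverse)
  have map_rT: "map rtype (map T L) = L"
    by (simp add: comp_def rT)
  have off: "offspring (Node a (map T L)) = q"
  proof
    fix j
    have "offspring (Node a (map T L)) j = length (filter (\<lambda>x. x = j) L)"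
      by (simp add: offspring_def filter_map comp_def rT)
    also have "\<dots> = count (mset L) j" by (induction L) auto
    finally show "offspring (Node a (map T L)) j = q j" by (simp add: cnt)
  qed
  have "sorted L" by (simp add: L_def)
  then have "gw_weight \<nu> a (Node a (map T L)) =
      pmf (\<nu> a) q * (\<Prod>s\<leftarrow>map T L. gw_weight \<nu> (rtype s) s)"
    using gw_weight_Node[of "map T L" \<nu> a] map_rT off by (simp only:)
  moreover have "(\<Prod>s\<leftarrow>map T L. gw_weight \<nu> (rtype s) s) > 0"
    by (induction L) (simp_all add: rT T)
  ultimately have "gw_weight \<nu> a (Node a (map T L)) > 0" using q by simp
  moreover have "T j \<in> set (map T L)" if "q j > 0" for j
  proof -
    have "count (mset L) j > 0" using that by (simp only: cnt)
    then have "j \<in># mset L" by (simp only: count_greater_zero_iff)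
    then show ?thesis by auto
  qed
  ultimately show ?thesis by blast
qed

lemma mean_matrix_pos:
  assumes "mean_matrix \<nu> a b > 0"
  shows "\<exists>q. pmf (\<nu> a) q > 0 \<and> q b > 0"
proof (rule ccontr)
  assume "\<not> ?thesis"
  then have "AE q in measure_pmf (\<nu> a). real (q b) = 0"
    by (auto simp: AE_measure_pmf_iff set_pmf_iff pmf_pos)
  then have "measure_pmf.expectation (\<nu> a) (\<lambda>q. real (q b)) = measure_pmf.expectation (\<nu> a) (\<lambda>q. 0)"
    by (intro integral_cong_AE) auto
  then show False using assms by (simp add: mean_matrix_def)
qed

lemma mat_pow_nonneg:
  assumes "\<And>i j. 0 \<le> A i j"
  shows "0 \<le> mat_pow A n i j"
  by (induction n arbitrary: i j) (auto intro!: sum_nonneg mult_nonneg_nonneg assms)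

text \<open>The types that start a tree of positive weight containing type \<open>i\<close> include
  \<open>i\<close>, and with \<open>b\<close> every \<open>a\<close> such that
  \<open>mean_matrix \<nu> a b > 0\<close>. Irreducibility then gives all types.\<close>

lemma exists_tree_with_type:
  fixes \<nu> :: "'t::{finite,linorder} \<Rightarrow> ('t \<Rightarrow> nat) pmf"
  assumes irr: "irreducible_law \<nu>" and pos: "\<And>j. \<exists>t. gw_weight \<nu> j t > 0"
  shows "\<exists>t. gw_weight \<nu> a t > 0 \<and> type_vertices i t \<noteq> []"
proof -
  define W where "W = {a. \<exists>t. gw_weight \<nu> a t > 0 \<and> (\<exists>u\<in>#vertices t. rtype u = i)}"
  obtain T where T: "\<And>j. gw_weight \<nu> j (T j) > 0" using pos by metis
  have nn: "0 \<le> mean_matrix \<nu> a b" for a b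
    by (simp add: mean_matrix_def)
  have self: "t \<in># vertices t" for t :: "'t ttree" by (cases t) simp
  have "rtype (T i) = i" using T[of i] by (auto simp: gw_weight_def split: if_splits)
  then have iW: "i \<in> W" unfolding W_def using T self by blast
  have step: "a \<in> W" if ab: "mean_matrix \<nu> a b > 0" and b: "b \<in> W" for a b
  proof -
    obtain q where q: "pmf (\<nu> a) q > 0" "q b > 0" using mean_matrix_pos[OF ab] by blast
    obtain t u where t: "gw_weight \<nu> b t > 0" "u \<in># vertices t" "rtype u = i"
      using b unfolding W_def by blast
    \<comment> \<open>The tree containing type \<open>i\<close> is hung at the children of type
      \<open>b\<close>, some tree of positive weight at each other child.\<close>
    have "gw_weight \<nu> j ((T(b := t)) j) > 0" for j using T t(1) by simp
    from extend_tree[OF q(1) this] obtain ts where ts: "gw_weight \<nu> a (Node a ts) > 0"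
      "\<And>j. q j > 0 \<Longrightarrow> (T(b := t)) j \<in> set ts" by blast
    have "t \<in> set ts" using ts(2)[OF q(2)] by simp
    then have "u \<in># (\<Sum>s\<leftarrow>ts. vertices s)" using t(2) by (induction ts) auto
    then have "u \<in># vertices (Node a ts)" by simp
    then show ?thesis unfolding W_def using ts(1) t(3) by blast
  qed
  have path: "b \<in> W \<Longrightarrow> mat_pow (mean_matrix \<nu>) n a b > 0 \<Longrightarrow> a \<in> W" for n a b
  proof (induction n arbitrary: b)
    case 0
    then show ?case by (auto split: if_splits)
  next
    case (Suc n)
    have "\<exists>k. mat_pow (mean_matrix \<nu>) n a k * mean_matrix \<nu> k b > 0"
    proof (rule ccontr)
      assume "\<nexists>k. mat_pow (mean_matrix \<nu>) n a k * mean_matrix \<nu> k b > 0"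
      then have "(\<Sum>k\<in>UNIV. mat_pow (mean_matrix \<nu>) n a k * mean_matrix \<nu> k b) \<le> 0"
        by (intro sum_nonpos) (simp add: not_less)
      then show False using Suc.prems(2) by simp
    qed
    then obtain k where k: "mat_pow (mean_matrix \<nu>) n a k * mean_matrix \<nu> k b > 0" ..
    have "mat_pow (mean_matrix \<nu>) n a k > 0" "mean_matrix \<nu> k b > 0"
      using k nn[of k b] mat_pow_nonneg[of "mean_matrix \<nu>" n a k, OF nn]
      by (auto simp: zero_less_mult_iff)
    then show ?case using step[OF _ Suc.prems(1)] Suc.IH by blast
  qed
  have "a \<in> W" using irr path[OF iW] unfolding irreducible_law_def by blast
  then show ?thesis unfolding W_def rtype_in_vertices by blast
qed

text \<open>Second Borel-Cantelli lemma with a uniform lower bound: \<open>n\<close> misses in a row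
  have probability at most \<open>(1 - p) ^ n\<close>.\<close>

lemma (in prob_space) AE_infinitely_often:
  assumes ind: "indep_vars (\<lambda>_. count_space UNIV) X (UNIV :: nat set)"
    and p: "0 < p" "\<And>k. p \<le> prob {\<omega> \<in> space M. X k \<omega> \<in> B k}"
  shows "AE \<omega> in M. \<exists>\<^sub>\<infinity>k. X k \<omega> \<in> B k"
proof -
  have rv [measurable]: "X k \<in> measurable M (count_space UNIV)" for k
    using ind by (auto simp: indep_vars_def)
  have ev [measurable]: "{\<omega> \<in> space M. X k \<omega> \<in> C} \<in> events" for k C
    using measurable_sets[OF rv[of k], of C] by (simp add: vimage_def Int_def conj_commute)
  have p1: "p \<le> 1" using p(2)[of 0] prob_le_1 order_trans by blast
  have zero: "AE \<omega> in M. \<exists>k\<ge>m. X k \<omega> \<in> B k" for m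
  proof -
    define N where "N = {\<omega> \<in> space M. \<forall>k\<ge>m. X k \<omega> \<in> - B k}"
    have N: "N \<in> events"
    proof -
      have "N = (\<Inter>k\<in>{m..}. {\<omega> \<in> space M. X k \<omega> \<in> - B k})" by (auto simp: N_def)
      then show ?thesis using ev by (auto intro!: sets.countable_INT)
    qed
    have le: "prob N \<le> (1 - p) ^ n" for n
    proof (cases n)
      case (Suc n')
      let ?A = "\<lambda>k. X k -` (- B k) \<inter> space M"
      have A: "?A k = {\<omega> \<in> space M. X k \<omega> \<in> - B k}" for k by auto
      have "prob N \<le> prob (\<Inter>k\<in>{m..<m + n}. ?A k)"
        using Suc ev by (intro finite_measure_mono) (auto simp: N_def A intro!: sets.finite_INT)
      also have "\<dots> = (\<Prod>k\<in>{m..<m + n}. prob (?A k))"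
        using Suc by (intro indep_varsD[OF ind]) auto
      also have "\<dots> \<le> (\<Prod>k\<in>{m..<m + n}. 1 - p)"
      proof (intro prod_mono conjI)
        fix k
        have "?A k = space M - {\<omega> \<in> space M. X k \<omega> \<in> B k}" by auto
        then have "prob (?A k) = 1 - prob {\<omega> \<in> space M. X k \<omega> \<in> B k}"
          by (simp add: prob_compl)
        then show "prob (?A k) \<le> 1 - p" using p(2)[of k] by simp
      qed auto
      finally show ?thesis by simp
    qed (simp add: prob_le_1)
    have "(\<lambda>n. (1 - p) ^ n) \<longlonglongrightarrow> 0" using p(1) p1 by (intro LIMSEQ_realpow_zero) auto
    then have "prob N \<le> 0" using le by (intro LIMSEQ_le_const) auto
    then have "N \<in> null_sets M"
      using N by (simp add: null_setsI emeasure_eq_measure measure_le_0_iff)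
    then show ?thesis by (rule AE_I') (auto simp: N_def)
  qed
  have "AE \<omega> in M. \<forall>m. \<exists>k\<ge>m. X k \<omega> \<in> B k" using zero by (simp add: AE_all_countable)
  then show ?thesis by (simp add: INFM_nat_le)
qed

lemma branching_forest_subforest_infinite:
  fixes \<nu> :: "'t::{finite,linorder} \<Rightarrow> ('t \<Rightarrow> nat) pmf"
  assumes irr: "irreducible_law \<nu>" and pos: "\<And>j. \<exists>t. gw_weight \<nu> j t > 0"
    and forest: "branching_forest M F \<nu> c"
  shows "AE \<omega> in M. \<forall>i. subforest_infinite (F \<omega>) i"
proof -
  interpret prob_space M using forest by (simp add: branching_forest_def)
  have ind: "indep_vars (\<lambda>_. count_space UNIV) (\<lambda>k \<omega>. F \<omega> k) UNIV"
    and law: "\<And>k t. prob {\<omega> \<in> space M. F \<omega> k = t} = gw_weight \<nu> (c k) t"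
    using forest by (simp_all add: branching_forest_def)
  have rv: "(\<lambda>\<omega>. F \<omega> k) \<in> measurable M (count_space UNIV)" for k
    using ind by (auto simp: indep_vars_def)
  have "AE \<omega> in M. subforest_infinite (F \<omega>) i" for i
    unfolding subforest_infinite_iff
  proof -
    obtain t where t: "\<And>a. gw_weight \<nu> a (t a) > 0" "\<And>a. type_vertices i (t a) \<noteq> []"
      using exists_tree_with_type[OF irr pos, of _ i] by metis
    \<comment> \<open>The root type varies with \<open>k\<close>; the minimum over the finitely many
      types is a bound for all \<open>k\<close> at once.\<close>
    define p where "p = Min (range (\<lambda>a. gw_weight \<nu> a (t a)))"
    have p: "0 < p" using t(1) by (simp add: p_def)
    have "AE \<omega> in M. \<exists>\<^sub>\<infinity>k. F \<omega> k \<in> {s. type_vertices i s \<noteq> []}"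
    proof (rule AE_infinitely_often[OF ind p])
      fix k
      have "p \<le> prob {\<omega> \<in> space M. F \<omega> k = t (c k)}" unfolding law p_def by (rule Min_le) auto
      also have "\<dots> \<le> prob {\<omega> \<in> space M. F \<omega> k \<in> {s. type_vertices i s \<noteq> []}}"
        using t(2) measurable_sets[OF rv[of k], of "{s. type_vertices i s \<noteq> []}"]
        by (intro finite_measure_mono) (auto simp: vimage_def Int_def conj_commute)
      finally show "p \<le> prob {\<omega> \<in> space M. F \<omega> k \<in> {s. type_vertices i s \<noteq> []}}" .
    qed
    then show "AE \<omega> in M. \<exists>\<^sub>\<infinity>k. type_vertices i (F \<omega> k) \<noteq> []" by simp
  qed
  then show ?thesis by (simp add: AE_all_countable)
qed

section \<open>Decoding an array of independent offspring vectors\<close>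

text \<open>Countably many trees: laws of trees and of finite forests are determined by the
  probabilities of single values.\<close>

instance ttree :: (countable) countable
  by countable_datatype

definition array_law :: "('t \<Rightarrow> ('t \<Rightarrow> nat) pmf) \<Rightarrow> ('t \<times> nat \<Rightarrow> 't \<Rightarrow> nat) measure" where
  "array_law \<nu> = Pi\<^sub>M UNIV (\<lambda>(i, n::nat). measure_pmf (\<nu> i))"

abbreviation forest_space :: "(nat \<Rightarrow> 't ttree) measure" where
  "forest_space \<equiv> Pi\<^sub>M UNIV (\<lambda>_. count_space UNIV)"

abbreviation array_space :: "('t \<times> nat \<Rightarrow> 't \<Rightarrow> nat) measure" where
  "array_space \<equiv> Pi\<^sub>M UNIV (\<lambda>_. count_space UNIV)"

definition rooted_forest :: "(nat \<Rightarrow> 't::linorder) \<Rightarrow> 't ttree list \<Rightarrow> bool" where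
  "rooted_forest c ts \<longleftrightarrow> (\<forall>t\<in>set ts. wf_tree t) \<and> map rtype ts = map c [0..<length ts]"

lemma sets_array_law [measurable_cong]: "sets (array_law \<nu>) = sets array_space"
  unfolding array_law_def by (intro sets_PiM_cong) (auto split: prod.splits)

lemma space_array_law [simp]: "space (array_law \<nu>) = UNIV"
  by (subst sets_eq_imp_space_eq[OF sets_array_law]) (simp add: space_PiM)

lemma product_prob_space_array: "product_prob_space (\<lambda>(i, n::nat). measure_pmf (\<nu> i))"
proof -
  interpret prob_space "(\<lambda>(i, n::nat). measure_pmf (\<nu> i)) p" for p
    by (cases p) (simp add: measure_pmf.prob_space_axioms)
  show ?thesis by unfold_locales
qed

lemma prob_space_array_law: "prob_space (array_law \<nu>)"
  unfolding array_law_def by (intro prob_space_PiM) (auto simp: measure_pmf.prob_space_axioms split: prod.splits)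

text \<open>A cylinder event: only the finitely many entries in \<open>?J\<close> are constrained,
  each to a single value.\<close>

lemma prob_codes_forest:
  fixes \<nu> :: "'t::{finite,linorder} \<Rightarrow> ('t \<Rightarrow> nat) pmf"
  shows "emeasure (array_law \<nu>) {x. codes_forest x ts} =
    ennreal (\<Prod>i\<in>UNIV. \<Prod>q\<leftarrow>concat (map (code i) ts). pmf (\<nu> i) q)"
proof -
  interpret product_prob_space "\<lambda>(i, n::nat). measure_pmf (\<nu> i)" UNIV
    by (rule product_prob_space_array)
  let ?L = "\<lambda>i. concat (map (code i) ts)"
  let ?J = "SIGMA i:UNIV. {..<length (?L i)}"
  have sp: "space (Pi\<^sub>M UNIV (\<lambda>(i, n::nat). measure_pmf (\<nu> i))) = UNIV"
    using space_array_law[of \<nu>] by (simp add: array_law_def)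
  have "{x. codes_forest x ts} = {x \<in> space (Pi\<^sub>M UNIV (\<lambda>(i, n::nat). measure_pmf (\<nu> i))).
      \<forall>p\<in>?J. x p \<in> {?L (fst p) ! snd p}}"
    unfolding sp codes_forest_def by auto
  then have "emeasure (array_law \<nu>) {x. codes_forest x ts} =
      (\<Prod>p\<in>?J. emeasure ((\<lambda>(i, n::nat). measure_pmf (\<nu> i)) p) {?L (fst p) ! snd p})"
    unfolding array_law_def by (subst emeasure_PiM_Collect[symmetric]) auto
  also have "\<dots> = (\<Prod>p\<in>?J. ennreal (pmf (\<nu> (fst p)) (?L (fst p) ! snd p)))"
    by (intro prod.cong) (auto simp: emeasure_pmf_single)
  also have "\<dots> = ennreal (\<Prod>p\<in>?J. pmf (\<nu> (fst p)) (?L (fst p) ! snd p))"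
    by (simp add: prod_ennreal)
  also have "(\<Prod>p\<in>?J. pmf (\<nu> (fst p)) (?L (fst p) ! snd p)) =
      (\<Prod>i\<in>UNIV. \<Prod>n<length (?L i). pmf (\<nu> i) (?L i ! n))"
    by (subst prod.Sigma) (auto simp: case_prod_beta)
  also have "\<dots> = (\<Prod>i\<in>UNIV. \<Prod>q\<leftarrow>?L i. pmf (\<nu> i) q)"
  proof (intro prod.cong refl)
    fix i
    show "(\<Prod>n<length (?L i). pmf (\<nu> i) (?L i ! n)) = (\<Prod>q\<leftarrow>?L i. pmf (\<nu> i) q)"
      unfolding prod.list_conv_set_nth by (intro prod.cong) auto
  qed
  finally show ?thesis .
qed

lemma prod_codes_eq_gw_weight:
  fixes \<nu> :: "'t::{finite,linorder} \<Rightarrow> ('t \<Rightarrow> nat) pmf"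
  assumes "\<forall>t\<in>set ts. wf_tree t"
  shows "(\<Prod>i\<in>UNIV. \<Prod>q\<leftarrow>concat (map (code i) ts). pmf (\<nu> i) q) =
    (\<Prod>t\<leftarrow>ts. gw_weight \<nu> (rtype t) t)"
  using assms by (induction ts) (simp_all add: prod.distrib gw_weight_code)

lemma prob_codes_rooted_forest:
  fixes \<nu> :: "'t::{finite,linorder} \<Rightarrow> ('t \<Rightarrow> nat) pmf"
  assumes "rooted_forest c ts"
  shows "emeasure (array_law \<nu>) {x. codes_forest x ts} =
    ennreal (\<Prod>k<length ts. gw_weight \<nu> (c k) (ts ! k))"
proof -
  have "(\<Prod>t\<leftarrow>ts. gw_weight \<nu> (rtype t) t) = (\<Prod>k<length ts. gw_weight \<nu> (rtype (ts ! k)) (ts ! k))"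
    unfolding prod.list_conv_set_nth by (intro prod.cong) auto
  also have "\<dots> = (\<Prod>k<length ts. gw_weight \<nu> (c k) (ts ! k))"
  proof (intro prod.cong refl)
    fix k assume "k \<in> {..<length ts}"
    moreover have "map rtype ts ! k = map c [0..<length ts] ! k"
      using assms by (simp only: rooted_forest_def)
    ultimately have "rtype (ts ! k) = c k" by simp
    then show "gw_weight \<nu> (rtype (ts ! k)) (ts ! k) = gw_weight \<nu> (c k) (ts ! k)" by simp
  qed
  finally show ?thesis
    using prod_codes_eq_gw_weight[of ts \<nu>] assms
    by (simp add: prob_codes_forest rooted_forest_def)
qed

lemma forest_prefix_measurable:
  "(\<lambda>f. map f [0..<m]) \<in> measurable forest_space (count_space (UNIV :: 't::countable ttree list set))"
proof (subst measurable_count_space_eq_countable)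
  show "(\<lambda>f. map f [0..<m]) \<in> space forest_space \<rightarrow> UNIV \<and> (\<forall>ts\<in>UNIV.
      (\<lambda>f. map f [0..<m]) -` {ts} \<inter> space forest_space \<in> sets (forest_space :: (nat \<Rightarrow> 't ttree) measure))"
  proof (intro conjI ballI)
    fix ts :: "'t ttree list"
    have "map f [0..<m] = ts \<longleftrightarrow> length ts = m \<and> (\<forall>k<m. f k = ts ! k)" for f
      unfolding list_eq_iff_nth_eq by auto
    then have "(\<lambda>f. map f [0..<m]) -` {ts} \<inter> space forest_space =
        {f \<in> space forest_space. length ts = m \<and> (\<forall>k<m. f k = ts ! k)}"
      by (auto simp del: space_PiM)
    also have "\<dots> \<in> sets forest_space" by measurable
    finally show "(\<lambda>f. map f [0..<m]) -` {ts} \<inter> space forest_space \<in> sets forest_space" .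
  qed simp
qed simp

lemma offspring_array_measurable:
  "offspring_array \<in> measurable forest_space (array_space :: ('t::{finite,linorder} \<times> nat \<Rightarrow> 't \<Rightarrow> nat) measure)"
proof -
  have pv [measurable]: "(\<lambda>f. prefix_vertices f i m) \<in> measurable forest_space (count_space UNIV)"
    for i :: 't and m
  proof -
    have "(\<lambda>f. prefix_vertices f i m) = (\<lambda>ts. concat (map (type_vertices i) ts)) \<circ> (\<lambda>f. map f [0..<m])"
      by (simp add: fun_eq_iff prefix_vertices_def comp_def)
    then show ?thesis
      by (simp only:) (rule measurable_comp[OF forest_prefix_measurable], simp)
  qed
  have "(\<lambda>f. offspring (vertex_seq f i n)) \<in> measurable forest_space (count_space UNIV)" for i :: 't and n
  proof -
    have L: "(\<lambda>f. LEAST m. n < length (prefix_vertices f i m)) \<in> measurable forest_space (count_space UNIV)"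
      by measurable
    have "(\<lambda>f. offspring (prefix_vertices f i m ! n)) \<in> measurable forest_space (count_space UNIV)" for m
      by measurable
    from measurable_compose_countable[OF this L] show ?thesis
      unfolding vertex_seq_def .
  qed
  then have "(\<lambda>f. offspring_array f p) \<in> measurable forest_space (count_space UNIV)" for p :: "'t \<times> nat"
    by (cases p) (simp add: offspring_array_def)
  then show ?thesis by (intro measurable_PiM_single') auto
qed

text \<open>A decoded list is unique for each array but exists only almost surely; on the remaining
  arrays the value is unspecified, and uniqueness alone gives measurability.\<close>

definition decode_list :: "(nat \<Rightarrow> 't::linorder) \<Rightarrow> nat \<Rightarrow> ('t \<times> nat \<Rightarrow> 't \<Rightarrow> nat) \<Rightarrow> 't ttree list" where
  "decode_list c m x = (THE ts. length ts = m \<and> rooted_forest c ts \<and> codes_forest x ts)"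

definition decode :: "(nat \<Rightarrow> 't::linorder) \<Rightarrow> ('t \<times> nat \<Rightarrow> 't \<Rightarrow> nat) \<Rightarrow> nat \<Rightarrow> 't ttree" where
  "decode c x k = last (decode_list c (Suc k) x)"

lemma rooted_codes_unique:
  assumes "length ts = length ts'" "rooted_forest c ts" "rooted_forest c ts'"
    "codes_forest x ts" "codes_forest x ts'"
  shows "ts = ts'"
  using assms by (intro codes_forest_unique[of x]) (auto simp: rooted_forest_def)

lemma decode_list_eqI:
  assumes "length ts = m" "rooted_forest c ts" "codes_forest x ts"
  shows "decode_list c m x = ts"
  unfolding decode_list_def
proof (rule the_equality)
  fix ts' assume "length ts' = m \<and> rooted_forest c ts' \<and> codes_forest x ts'"
  then show "ts' = ts" using assms rooted_codes_unique[of ts' ts c x] by simp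
qed (use assms in simp)

lemma rooted_forest_appendD: "rooted_forest c (ts @ ts') \<Longrightarrow> rooted_forest c ts"
proof -
  assume *: "rooted_forest c (ts @ ts')"
  have "map rtype ts @ map rtype ts' =
      map c [0..<length ts] @ map c [length ts..<length ts + length ts']"
    using * by (simp add: rooted_forest_def upt_add_eq_append[of 0 "length ts" "length ts'"])
  then have "map rtype ts = map c [0..<length ts]"
    by (rule iffD1[OF append_eq_append_conv[OF disjI1], THEN conjunct1, rotated]) simp
  then show ?thesis using * by (simp add: rooted_forest_def)
qed

text \<open>Dropping the last of \<open>m + 1\<close> decoded trees gives a decoding into
  \<open>m\<close> trees, so uniqueness makes the finite decodings consistent.\<close>

lemma decode_prefix:
  assumes ex: "\<And>m. \<exists>ts. length ts = m \<and> rooted_forest c ts \<and> codes_forest x ts"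
  shows "map (decode c x) [0..<m] = decode_list c m x"
    and "rooted_forest c (map (decode c x) [0..<m])" and "codes_forest x (map (decode c x) [0..<m])"
proof -
  have D: "length (decode_list c m x) = m \<and> rooted_forest c (decode_list c m x) \<and>
      codes_forest x (decode_list c m x)" for m
  proof -
    obtain ts where ts: "length ts = m" "rooted_forest c ts" "codes_forest x ts" using ex[of m] by blast
    with decode_list_eqI[OF ts] show ?thesis by simp
  qed
  show eq: "map (decode c x) [0..<m] = decode_list c m x"
  proof (induction m)
    case 0
    then show ?case using D[of 0] by simp
  next
    case (Suc m)
    let ?l = "decode_list c (Suc m) x"
    have ne: "?l \<noteq> []" using D[of "Suc m"] by auto
    then have l: "butlast ?l @ [last ?l] = ?l" by simp
    have "decode_list c m x = butlast ?l"
    proof (rule decode_list_eqI)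
      show "length (butlast ?l) = m" using D[of "Suc m"] by simp
      show "rooted_forest c (butlast ?l)" using D[of "Suc m"] rooted_forest_appendD[of c "butlast ?l" "[last ?l]"] l by simp
      show "codes_forest x (butlast ?l)" using D[of "Suc m"] codes_forest_appendD[of x "butlast ?l" "[last ?l]"] l by simp
    qed
    then show ?case using Suc l by (simp add: decode_def)
  qed
  show "rooted_forest c (map (decode c x) [0..<m])" "codes_forest x (map (decode c x) [0..<m])"
    using D eq by simp_all
qed

lemma decode_unique:
  assumes "\<And>k. wf_tree (f k) \<and> rtype (f k) = c k" "\<And>m. codes_forest x (map f [0..<m])"
  shows "decode c x = f"
proof
  fix k
  have "decode_list c (Suc k) x = map f [0..<Suc k]"
    by (rule decode_list_eqI) (use assms in \<open>simp_all add: rooted_forest_def del: upt_Suc\<close>)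
  then show "decode c x k = f k" by (simp add: decode_def)
qed

lemma codes_forest_pred [measurable]:
  "Measurable.pred (array_space :: ('t::{finite,linorder} \<times> nat \<Rightarrow> 't \<Rightarrow> nat) measure) (\<lambda>x. codes_forest x ts)"
  unfolding codes_forest_def by measurable

lemma decode_measurable:
  "decode c \<in> measurable (array_space :: ('t::{finite,linorder} \<times> nat \<Rightarrow> 't \<Rightarrow> nat) measure) forest_space"
proof -
  have "decode_list c m \<in> measurable array_space (count_space (UNIV :: 't ttree list set))" for m
    unfolding decode_list_def[abs_def]
  proof (rule measurable_THE[where I = UNIV])
    fix x :: "'t \<times> nat \<Rightarrow> 't \<Rightarrow> nat" and ts ts' :: "'t ttree list"
    assume "length ts = m \<and> rooted_forest c ts \<and> codes_forest x ts"
      "length ts' = m \<and> rooted_forest c ts' \<and> codes_forest x ts'"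
    then show "ts = ts'" using rooted_codes_unique[of ts ts' c x] by simp
  qed (auto)
  then have "(\<lambda>x. decode c x k) \<in> measurable array_space (count_space (UNIV :: 't ttree set))" for k
    unfolding decode_def by (rule measurable_compose) simp
  then show ?thesis by (intro measurable_PiM_single') auto
qed

section \<open>The law of the forest and of its coding array\<close>

lemma branching_forestD:
  assumes "branching_forest M F \<nu> c"
  shows "prob_space M" "prob_space.indep_vars M (\<lambda>_. count_space UNIV) (\<lambda>k \<omega>. F \<omega> k) UNIV"
    "\<And>k t. measure M {\<omega> \<in> space M. F \<omega> k = t} = gw_weight \<nu> (c k) t"
    "\<And>k. (\<lambda>\<omega>. F \<omega> k) \<in> measurable M (count_space UNIV)"
    "F \<in> measurable M forest_space"
proof -
  show M: "prob_space M" and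
    ind: "prob_space.indep_vars M (\<lambda>_. count_space UNIV) (\<lambda>k \<omega>. F \<omega> k) UNIV" and
    "\<And>k t. measure M {\<omega> \<in> space M. F \<omega> k = t} = gw_weight \<nu> (c k) t"
    using assms by (simp_all add: branching_forest_def)
  interpret prob_space M by fact
  show rv: "(\<lambda>\<omega>. F \<omega> k) \<in> measurable M (count_space UNIV)" for k
    using ind by (auto simp: indep_vars_def)
  show "F \<in> measurable M forest_space"
    using measurable_PiM_single'[of UNIV "\<lambda>k \<omega>. F \<omega> k" M "\<lambda>_. count_space UNIV"] rv by simp
qed

lemma branching_forest_rooted:
  fixes F :: "'w \<Rightarrow> nat \<Rightarrow> 't::{finite,linorder} ttree"
  assumes "branching_forest M F \<nu> c"
  shows "AE \<omega> in M. \<forall>k. wf_tree (F \<omega> k) \<and> rtype (F \<omega> k) = c k"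
proof -
  note F = branching_forestD[OF assms]
  interpret prob_space M by (rule F)
  have "AE \<omega> in M. wf_tree (F \<omega> k) \<and> rtype (F \<omega> k) = c k" for k
  proof -
    have "AE \<omega> in M. \<not> (F \<omega> k = t)" if "\<not> (wf_tree t \<and> rtype t = c k)" for t
    proof -
      have "prob {\<omega> \<in> space M. F \<omega> k = t} = 0"
        using that by (auto simp: F(3) gw_weight_def)
      moreover have "{\<omega> \<in> space M. F \<omega> k = t} \<in> events"
        using measurable_sets[OF F(4)[of k], of "{t}"] by (simp add: vimage_def Int_def conj_commute)
      ultimately show ?thesis by (simp add: prob_Collect_eq_0)
    qed
    then have "AE \<omega> in M. \<forall>t\<in>{t. \<not> (wf_tree t \<and> rtype t = c k)}. \<not> (F \<omega> k = t)"
      by (subst AE_ball_countable) auto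
    then show ?thesis by eventually_elim auto
  qed
  then show ?thesis by (simp add: AE_all_countable)
qed

lemma branching_forest_prefix_prob:
  fixes F :: "'w \<Rightarrow> nat \<Rightarrow> 't::{finite,linorder} ttree"
  assumes "branching_forest M F \<nu> c"
  shows "emeasure M {\<omega> \<in> space M. map (F \<omega>) [0..<length ts] = ts} =
    ennreal (\<Prod>k<length ts. gw_weight \<nu> (c k) (ts ! k))"
proof -
  note F = branching_forestD[OF assms]
  interpret prob_space M by (rule F)
  show ?thesis
  \<comment> \<open>The product rule for independent events is applied to a nonempty index
    set.\<close>
  proof (cases "ts = []")
    case True
    then show ?thesis by (simp add: emeasure_space_1)
  next
    case False
    have "map f [0..<length ts] = ts \<longleftrightarrow> (\<forall>k<length ts. f k = ts ! k)" for f
      unfolding list_eq_iff_nth_eq by auto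
    then have "{\<omega> \<in> space M. map (F \<omega>) [0..<length ts] = ts} =
        (\<Inter>k\<in>{..<length ts}. (\<lambda>\<omega>. F \<omega> k) -` {ts ! k} \<inter> space M)"
      using False by auto
    also have "emeasure M \<dots> = ennreal (\<Prod>k<length ts. prob ((\<lambda>\<omega>. F \<omega> k) -` {ts ! k} \<inter> space M))"
      unfolding emeasure_eq_measure using False by (subst indep_varsD[OF F(2)]) auto
    also have "(\<lambda>k. prob ((\<lambda>\<omega>. F \<omega> k) -` {ts ! k} \<inter> space M)) = (\<lambda>k. gw_weight \<nu> (c k) (ts ! k))"
      by (simp add: F(3)[symmetric] vimage_def Int_def conj_commute)
    finally show ?thesis .
  qed
qed

text \<open>By uniqueness, decodability into \<open>m\<close> trees is a disjoint countable union
  over rooted forests. Term by term its probability is that of a value of the first \<open>m\<close>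
  trees of \<open>F\<close>, and these values have total mass one.\<close>

lemma AE_array_decodable:
  fixes F :: "'w \<Rightarrow> nat \<Rightarrow> 't::{finite,linorder} ttree"
  assumes "branching_forest M F \<nu> c"
  shows "AE x in array_law \<nu>. \<forall>m. \<exists>ts. length ts = m \<and> rooted_forest c ts \<and> codes_forest x ts"
proof -
  note F = branching_forestD[OF assms]
  interpret M: prob_space M by (rule F)
  interpret Q: prob_space "array_law \<nu>" by (rule prob_space_array_law)
  have "AE x in array_law \<nu>. \<exists>ts. length ts = m \<and> rooted_forest c ts \<and> codes_forest x ts" for m
  proof -
    define U where "U = {ts. length ts = m \<and> rooted_forest c ts}"
    have pre: "(\<lambda>\<omega>. map (F \<omega>) [0..<m]) \<in> measurable M (count_space UNIV)"
      by (rule measurable_compose[OF F(5) forest_prefix_measurable])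
    have ev: "{\<omega> \<in> space M. map (F \<omega>) [0..<m] = ts} \<in> sets M" for ts
      using measurable_sets[OF pre, of "{ts}"] by (simp add: vimage_def Int_def conj_commute)
    have ev': "{x. codes_forest x ts} \<in> sets (array_law \<nu>)" for ts
    proof -
      have "{x \<in> space array_space. codes_forest x ts} \<in> sets array_space"
        by measurable
      then show ?thesis by (simp add: sets_array_law space_PiM)
    qed
    have "emeasure (array_law \<nu>) (\<Union>ts\<in>U. {x. codes_forest x ts}) =
        (\<integral>\<^sup>+ts. emeasure (array_law \<nu>) {x. codes_forest x ts} \<partial>count_space U)"
    proof (rule emeasure_UN_countable)
      show "disjoint_family_on (\<lambda>ts. {x. codes_forest x ts}) U"
        unfolding disjoint_family_on_def
      proof (intro ballI impI)
        fix ts ts' assume ts: "ts \<in> U" "ts' \<in> U" "ts \<noteq> ts'"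
        show "{x. codes_forest x ts} \<inter> {x. codes_forest x ts'} = {}"
          using ts rooted_codes_unique[of ts ts' c] by (auto simp: U_def)
      qed
    qed (use ev' in auto)
    also have "\<dots> = (\<integral>\<^sup>+ts. emeasure M {\<omega> \<in> space M. map (F \<omega>) [0..<m] = ts} \<partial>count_space U)"
    proof (rule nn_integral_cong)
      fix ts assume "ts \<in> space (count_space U)"
      then have ts: "rooted_forest c ts" "length ts = m" by (auto simp: U_def)
      show "emeasure (array_law \<nu>) {x. codes_forest x ts} =
          emeasure M {\<omega> \<in> space M. map (F \<omega>) [0..<m] = ts}"
        using prob_codes_rooted_forest[OF ts(1), of \<nu>] branching_forest_prefix_prob[OF assms, of ts] ts(2)
        by simp
    qed
    also have "\<dots> = emeasure M (\<Union>ts\<in>U. {\<omega> \<in> space M. map (F \<omega>) [0..<m] = ts})"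
      by (rule emeasure_UN_countable[symmetric]) (use ev in \<open>auto simp: disjoint_family_on_def\<close>)
    also have "\<dots> = emeasure M (space M)"
    proof (rule emeasure_eq_AE)
      show "AE \<omega> in M. \<omega> \<in> (\<Union>ts\<in>U. {\<omega> \<in> space M. map (F \<omega>) [0..<m] = ts}) \<longleftrightarrow> \<omega> \<in> space M"
        using branching_forest_rooted[OF assms]
      proof eventually_elim
        case (elim \<omega>)
        then have "map (F \<omega>) [0..<m] \<in> U" by (auto simp: U_def rooted_forest_def)
        then show ?case by auto
      qed
    qed (use ev in \<open>auto intro!: sets.countable_UN''\<close>)
    finally have "emeasure (array_law \<nu>) (\<Union>ts\<in>U. {x. codes_forest x ts}) = 1"
      by (simp add: M.emeasure_space_1)
    then have "AE x in array_law \<nu>. x \<in> (\<Union>ts\<in>U. {x. codes_forest x ts})"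
      using ev' by (intro Q.AE_prob_1) (simp add: Q.emeasure_eq_measure)
    then show ?thesis by eventually_elim (auto simp: U_def)
  qed
  then show ?thesis by (simp add: AE_all_countable)
qed

text \<open>For a finite rooted forest \<open>ts\<close>, decoding to \<open>ts\<close> and coding
  \<open>ts\<close> are almost surely the same event, so both laws agree on finite prefixes.\<close>

lemma distr_decode:
  fixes F :: "'w \<Rightarrow> nat \<Rightarrow> 't::{finite,linorder} ttree"
  assumes "branching_forest M F \<nu> c"
  shows "distr (array_law \<nu>) forest_space (decode c) = distr M forest_space F"
proof -
  note F = branching_forestD[OF assms]
  interpret M: prob_space M by (rule F)
  interpret Q: prob_space "array_law \<nu>" by (rule prob_space_array_law)
  have dec: "decode c \<in> measurable (array_law \<nu>) forest_space"
    using decode_measurable[of c] by (simp add: measurable_cong_sets[OF sets_array_law refl])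
  let ?p = "\<lambda>m f. map f [0..<m]"
  have prefix: "distr (array_law \<nu>) (count_space UNIV) (\<lambda>x. ?p m (decode c x)) =
      distr M (count_space UNIV) (\<lambda>\<omega>. ?p m (F \<omega>))" (is "?L = ?R") for m
  proof (rule measure_eqI_countable_AE[where \<Omega> = "{ts. length ts = m \<and> rooted_forest c ts}"])
    have mQ: "(\<lambda>x. ?p m (decode c x)) \<in> measurable (array_law \<nu>) (count_space UNIV)"
      by (rule measurable_compose[OF dec forest_prefix_measurable])
    have mM: "(\<lambda>\<omega>. ?p m (F \<omega>)) \<in> measurable M (count_space UNIV)"
      by (rule measurable_compose[OF F(5) forest_prefix_measurable])
    show "AE ts in ?L. ts \<in> {ts. length ts = m \<and> rooted_forest c ts}"
      unfolding AE_distr_iff[OF mQ, simplified]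
      using AE_array_decodable[OF assms] by eventually_elim (use decode_prefix(2) in auto)
    show "AE ts in ?R. ts \<in> {ts. length ts = m \<and> rooted_forest c ts}"
      unfolding AE_distr_iff[OF mM, simplified]
      using branching_forest_rooted[OF assms] by eventually_elim (auto simp: rooted_forest_def)
    fix ts assume "ts \<in> {ts. length ts = m \<and> rooted_forest c ts}"
    then have ts: "length ts = m" "rooted_forest c ts" by auto
    have ev': "{x. codes_forest x ts} \<in> sets (array_law \<nu>)"
    proof -
      have "{x \<in> space array_space. codes_forest x ts} \<in> sets array_space"
        by measurable
      then show ?thesis by (simp add: sets_array_law space_PiM)
    qed
    have "emeasure ?L {ts} = emeasure (array_law \<nu>) {x. ?p m (decode c x) = ts}"
      by (subst emeasure_distr[OF mQ]) (auto simp: vimage_def)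
    also have "\<dots> = emeasure (array_law \<nu>) {x. codes_forest x ts}"
    proof (rule emeasure_eq_AE)
      show "AE x in array_law \<nu>. x \<in> {x. ?p m (decode c x) = ts} \<longleftrightarrow> x \<in> {x. codes_forest x ts}"
        using AE_array_decodable[OF assms]
      proof eventually_elim
        case (elim x)
        then have ex: "\<exists>ts. length ts = m \<and> rooted_forest c ts \<and> codes_forest x ts" for m by blast
        show ?case
          using decode_prefix(1,3)[OF ex, of m] decode_list_eqI[OF ts(1,2), of x] by auto
      qed
      show "{x. ?p m (decode c x) = ts} \<in> sets (array_law \<nu>)"
        using measurable_sets[OF mQ, of "{ts}"] by (simp add: vimage_def)
    qed (rule ev')
    also have "\<dots> = emeasure M {\<omega> \<in> space M. ?p m (F \<omega>) = ts}"
      using prob_codes_rooted_forest[OF ts(2), of \<nu>] branching_forest_prefix_prob[OF assms, of ts] ts(1)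
      by simp
    also have "\<dots> = emeasure ?R {ts}"
      by (subst emeasure_distr[OF mM]) (auto simp: vimage_def Int_def conj_commute)
    finally show "emeasure ?L {ts} = emeasure ?R {ts}" .
  qed auto
  show ?thesis
  proof (rule measure_eqI_PiM_infinite[where I = UNIV and M = "\<lambda>_. count_space UNIV"])
    fix A :: "nat \<Rightarrow> 't ttree set" and J :: "nat set"
    assume "finite J"
    \<comment> \<open>A finite index set lies in an initial segment, so the cylinder is an event of
      the first \<open>m\<close> trees.\<close>
    then obtain m where m: "\<And>j. j \<in> J \<Longrightarrow> j < m" using finite_nat_bounded[of J] by auto
    let ?C = "prod_emb UNIV (\<lambda>_. count_space UNIV) J (Pi\<^sub>E J A)"
    let ?B = "{ts. \<forall>j\<in>J. ts ! j \<in> A j}"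
    have C: "?C = (\<lambda>f. ?p m f) -` ?B \<inter> space forest_space"
      using m by (auto simp: prod_emb_def space_PiM PiE_iff)
    have "emeasure (distr N forest_space G) ?C = emeasure (distr N (count_space UNIV) (\<lambda>x. ?p m (G x))) ?B"
      if G: "G \<in> measurable N forest_space" for G :: "'x \<Rightarrow> nat \<Rightarrow> 't ttree" and N
    proof -
      have "distr N (count_space UNIV) (\<lambda>x. ?p m (G x)) =
          distr (distr N forest_space G) (count_space UNIV) (?p m)"
        by (subst distr_distr[OF forest_prefix_measurable G]) (simp add: comp_def)
      then show ?thesis
        unfolding C
        by (simp only:) (subst emeasure_distr, auto intro: measurable_distr_eq1 simp: forest_prefix_measurable)
    qed
    note this[OF dec] this[OF F(5)]
    then show "emeasure (distr (array_law \<nu>) forest_space (decode c)) ?C = emeasure (distr M forest_space F) ?C"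
      by (simp only: prefix)
  next
    interpret prob_space "distr (array_law \<nu>) forest_space (decode c)"
      by (rule Q.prob_space_distr[OF dec])
    show "finite_measure (distr (array_law \<nu>) forest_space (decode c))" by unfold_locales
  qed auto
qed

text \<open>Being a branching forest depends on the joint law alone: independence is its product
  form, and the weights are its marginals.\<close>

lemma branching_forest_of_law:
  fixes F :: "'w \<Rightarrow> nat \<Rightarrow> 't::{finite,linorder} ttree" and G :: "'v \<Rightarrow> nat \<Rightarrow> 't ttree"
  assumes forest: "branching_forest M F \<nu> c" and N: "prob_space N"
    and G: "G \<in> measurable N forest_space"
    and law: "distr N forest_space G = distr M forest_space F"
  shows "branching_forest N G \<nu> c"
proof -
  note F = branching_forestD[OF forest]
  interpret M: prob_space M by (rule F)
  interpret N: prob_space N by (rule N)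
  have comp: "(\<lambda>f. f k) \<in> measurable forest_space (count_space (UNIV :: 't ttree set))" for k :: nat
    by (rule measurable_component_singleton) simp
  have rv: "(\<lambda>\<omega>. G \<omega> k) \<in> measurable N (count_space UNIV)" for k
    by (rule measurable_compose[OF G comp])
  have eq: "distr N (count_space UNIV) (\<lambda>\<omega>. G \<omega> k) = distr M (count_space UNIV) (\<lambda>\<omega>. F \<omega> k)" for k
  proof -
    have "distr (distr N forest_space G) (count_space UNIV) (\<lambda>f. f k) =
        distr (distr M forest_space F) (count_space UNIV) (\<lambda>f. f k)"
      by (simp only: law)
    then show ?thesis
      by (simp add: distr_distr[OF comp G] distr_distr[OF comp F(5)] comp_def)
  qed
  have "distr M forest_space F = Pi\<^sub>M UNIV (\<lambda>k. distr M (count_space UNIV) (\<lambda>\<omega>. F \<omega> k))"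
    using iffD1[OF M.indep_vars_iff_distr_eq_PiM[OF UNIV_not_empty F(4)] F(2)]
    by (simp add: restrict_UNIV)
  then have "distr N forest_space G = Pi\<^sub>M UNIV (\<lambda>k. distr N (count_space UNIV) (\<lambda>\<omega>. G \<omega> k))"
    by (simp only: eq law)
  then have "N.indep_vars (\<lambda>_. count_space UNIV) (\<lambda>k \<omega>. G \<omega> k) UNIV"
    using N.indep_vars_iff_distr_eq_PiM[where I = UNIV and M' = "\<lambda>_. count_space UNIV"
      and X = "\<lambda>k \<omega>. G \<omega> k", OF UNIV_not_empty rv]
    by (simp add: restrict_UNIV)
  moreover have "measure N {\<omega> \<in> space N. G \<omega> k = t} = gw_weight \<nu> (c k) t" for k t
  proof -
    have "measure N {\<omega> \<in> space N. G \<omega> k = t} = measure (distr N (count_space UNIV) (\<lambda>\<omega>. G \<omega> k)) {t}"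
      by (subst measure_distr[OF rv]) (auto simp: vimage_def Int_def conj_commute)
    also have "\<dots> = measure M {\<omega> \<in> space M. F \<omega> k = t}"
      unfolding eq by (subst measure_distr[OF F(4)]) (auto simp: vimage_def Int_def conj_commute)
    finally show ?thesis by (simp only: F(3))
  qed
  ultimately show ?thesis using N by (simp add: branching_forest_def)
qed

lemma branching_forest_decode:
  fixes F :: "'w \<Rightarrow> nat \<Rightarrow> 't::{finite,linorder} ttree"
  assumes "branching_forest M F \<nu> c" "prob_space N" "x \<in> measurable N array_space"
    and "distr N array_space x = array_law \<nu>"
  shows "branching_forest N (\<lambda>\<omega>. decode c (x \<omega>)) \<nu> c"
proof (rule branching_forest_of_law[OF assms(1,2)])
  show "(\<lambda>\<omega>. decode c (x \<omega>)) \<in> measurable N forest_space"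
    by (rule measurable_compose[OF assms(3) decode_measurable])
  have "distr N forest_space (\<lambda>\<omega>. decode c (x \<omega>)) = distr (distr N array_space x) forest_space (decode c)"
    by (simp add: distr_distr[OF decode_measurable assms(3)] comp_def)
  then show "distr N forest_space (\<lambda>\<omega>. decode c (x \<omega>)) = distr M forest_space F"
    by (simp only: assms(4) distr_decode[OF assms(1)])
qed

lemma distr_array_law_id: "distr (array_law \<nu>) array_space (\<lambda>x. x) = array_law \<nu>"
  by (rule distr_id2) (simp add: sets_array_law)

text \<open>The decoded forest is itself a branching forest, so all its subforests are infinite and
  coding it reads every entry of \<open>x\<close>.\<close>

lemma AE_offspring_array_decode:
  fixes F :: "'w \<Rightarrow> nat \<Rightarrow> 't::{finite,linorder} ttree"
  assumes irr: "irreducible_law \<nu>" and pos: "\<And>j. \<exists>t. gw_weight \<nu> j t > 0"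
    and forest: "branching_forest M F \<nu> c"
  shows "AE x in array_law \<nu>. offspring_array (decode c x) = x"
proof -
  have "branching_forest (array_law \<nu>) (\<lambda>x. decode c x) \<nu> c"
    by (rule branching_forest_decode[OF forest prob_space_array_law _ distr_array_law_id])
      (simp add: measurable_cong_sets[OF sets_array_law refl])
  from branching_forest_subforest_infinite[OF irr pos this] AE_array_decodable[OF forest]
  show ?thesis
  proof eventually_elim
    case (elim x)
    then have ex: "\<exists>ts. length ts = m \<and> rooted_forest c ts \<and> codes_forest x ts" for m by blast
    show ?case
      by (rule offspring_array_eqI) (use elim decode_prefix(3)[OF ex] in auto)
  qed
qed

text \<open>\<open>F\<close> has the law of the decoded forest, and coding the latter returns the
  array. The root sequence \<open>c\<close> cancels out, which is why the law of the walk does not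
  depend on it.\<close>

lemma distr_offspring_array:
  fixes F :: "'w \<Rightarrow> nat \<Rightarrow> 't::{finite,linorder} ttree"
  assumes irr: "irreducible_law \<nu>" and pos: "\<And>j. \<exists>t. gw_weight \<nu> j t > 0"
    and forest: "branching_forest M F \<nu> c"
  shows "distr M array_space (\<lambda>\<omega>. offspring_array (F \<omega>)) = array_law \<nu>"
proof -
  note F = branching_forestD[OF forest]
  have dec: "decode c \<in> measurable (array_law \<nu>) forest_space"
    using decode_measurable[of c] by (simp add: measurable_cong_sets[OF sets_array_law refl])
  have "distr M array_space (\<lambda>\<omega>. offspring_array (F \<omega>)) =
      distr (distr M forest_space F) array_space offspring_array"
    by (simp add: distr_distr[OF offspring_array_measurable F(5)] comp_def)
  also have "\<dots> = distr (distr (array_law \<nu>) forest_space (decode c)) array_space offspring_array"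
    by (simp only: distr_decode[OF forest])
  also have "\<dots> = distr (array_law \<nu>) array_space (\<lambda>x. offspring_array (decode c x))"
    by (simp add: distr_distr[OF offspring_array_measurable dec] comp_def)
  also have "\<dots> = distr (array_law \<nu>) array_space (\<lambda>x. x)"
  proof (rule distr_cong_AE)
    show "(\<lambda>x. offspring_array (decode c x)) \<in> measurable (array_law \<nu>) array_space"
      by (rule measurable_compose[OF dec offspring_array_measurable])
    show "(\<lambda>x. x) \<in> measurable (array_law \<nu>) array_space"
      by (simp add: measurable_cong_sets[OF sets_array_law refl])
  qed (use AE_offspring_array_decode[OF assms] in auto)
  finally show ?thesis by (simp only: distr_array_law_id)
qed

section \<open>The coding walk\<close>

text \<open>The first tree takes one of countably many values, so not all of them can have
  probability zero.\<close>

lemma exists_positive_gw_weight: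
  fixes F :: "'w \<Rightarrow> nat \<Rightarrow> 't::{finite,linorder} ttree"
  assumes "branching_forest M F \<nu> (\<lambda>_. j)"
  shows "\<exists>t. gw_weight \<nu> j t > 0"
proof (rule ccontr)
  assume "\<nexists>t. gw_weight \<nu> j t > 0"
  then have zero: "gw_weight \<nu> j t = 0" for t
    using gw_weight_nonneg[of \<nu> j t] by (metis less_eq_real_def)
  note F = branching_forestD[OF assms]
  interpret prob_space M by (rule F)
  have "AE \<omega> in M. \<not> (F \<omega> 0 = t)" for t
  proof -
    have "{\<omega> \<in> space M. F \<omega> 0 = t} \<in> events"
      using measurable_sets[OF F(4)[of 0], of "{t}"] by (simp add: vimage_def Int_def conj_commute)
    then show ?thesis using F(3)[of 0 t] zero by (simp add: prob_Collect_eq_0)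
  qed
  then have "AE \<omega> in M. \<forall>t. \<not> (F \<omega> 0 = t)" by (simp only: AE_all_countable) simp
  then show False by simp
qed

lemma offspring_array_indep:
  fixes F :: "'w \<Rightarrow> nat \<Rightarrow> 't::{finite,linorder} ttree"
  assumes F: "F \<in> measurable M forest_space" and M: "prob_space M"
    and law: "distr M array_space (\<lambda>\<omega>. offspring_array (F \<omega>)) = array_law \<nu>"
  shows "prob_space.indep_vars M (\<lambda>_. count_space UNIV) (\<lambda>p \<omega>. offspring_array (F \<omega>) p) UNIV"
    and "distr M (count_space UNIV) (\<lambda>\<omega>. offspring_array (F \<omega>) (i, n)) = measure_pmf (\<nu> i)"
proof -
  interpret prob_space M by (rule M)
  have arr: "(\<lambda>\<omega>. offspring_array (F \<omega>)) \<in> measurable M array_space"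
    by (rule measurable_compose[OF F offspring_array_measurable])
  have comp: "(\<lambda>x. x p) \<in> measurable array_space (count_space (UNIV :: ('t \<Rightarrow> nat) set))" for p :: "'t \<times> nat"
    by (rule measurable_component_singleton) simp
  have rv: "(\<lambda>\<omega>. offspring_array (F \<omega>) p) \<in> measurable M (count_space UNIV)" for p
    by (rule measurable_compose[OF arr comp])
  have marg: "distr M (count_space UNIV) (\<lambda>\<omega>. offspring_array (F \<omega>) p) = measure_pmf (\<nu> (fst p))" for p
  proof -
    have "distr M (count_space UNIV) (\<lambda>\<omega>. offspring_array (F \<omega>) p) =
        distr (array_law \<nu>) (count_space UNIV) (\<lambda>x. x p)"
      unfolding law[symmetric] by (simp add: distr_distr[OF comp arr] comp_def)
    also have "\<dots> = distr (array_law \<nu>) ((\<lambda>(i, n::nat). measure_pmf (\<nu> i)) p) (\<lambda>x. x p)"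
      by (rule distr_cong) (auto split: prod.splits)
    also have "\<dots> = (\<lambda>(i, n::nat). measure_pmf (\<nu> i)) p"
      unfolding array_law_def
      by (rule distr_PiM_component) (auto simp: measure_pmf.prob_space_axioms split: prod.splits)
    finally show ?thesis by (simp add: case_prod_beta)
  qed
  have "distr M array_space (\<lambda>\<omega>. offspring_array (F \<omega>)) =
      Pi\<^sub>M UNIV (\<lambda>p. distr M (count_space UNIV) (\<lambda>\<omega>. offspring_array (F \<omega>) p))"
    unfolding law marg array_law_def case_prod_beta ..
  then show "indep_vars (\<lambda>_. count_space UNIV) (\<lambda>p \<omega>. offspring_array (F \<omega>) p) UNIV"
    using indep_vars_iff_distr_eq_PiM[where I = UNIV and M' = "\<lambda>_. count_space UNIV"
      and X = "\<lambda>p \<omega>. offspring_array (F \<omega>) p", OF UNIV_not_empty rv]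
    by (simp add: restrict_UNIV)
  show "distr M (count_space UNIV) (\<lambda>\<omega>. offspring_array (F \<omega>) (i, n)) = measure_pmf (\<nu> i)"
    by (simp add: marg)
qed

definition walk_steps :: "'t \<times> nat \<Rightarrow> ('t \<Rightarrow> nat) \<Rightarrow> 't \<Rightarrow> int" where
  "walk_steps p q j = int (q j) - (if j = fst p then 1 else 0)"

lemma coding_walk_increment:
  "(\<lambda>j. coding_walk f i (Suc n) j - coding_walk f i n j) = walk_steps (i, n) (offspring_array f (i, n))"
  by (simp add: fun_eq_iff coding_walk_Suc walk_steps_def offspring_array_def)

text \<open>A vector with a coordinate below the range of the steps is never attained; for any
  other, \<open>nat\<close> loses nothing and the event is a single offspring vector.\<close>

lemma prob_walk_steps:
  "measure (measure_pmf (\<nu> i)) {v. walk_steps (i, n) v = q} = step_prob \<nu> i q"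
proof (cases "\<forall>j. 0 \<le> q j + (if j = i then 1 else 0)")
  case True
  have "walk_steps (i, n) v = q \<longleftrightarrow> v = (\<lambda>j. nat (q j + (if j = i then 1 else 0)))" for v
  proof -
    have "(int (v j) - (if j = i then 1 else 0) = q j) \<longleftrightarrow> v j = nat (q j + (if j = i then 1 else 0))" for j
      using True[rule_format, of j] by (auto split: if_splits)
    then show ?thesis by (simp add: fun_eq_iff walk_steps_def)
  qed
  then show ?thesis using True by (simp add: step_prob_def pmf.rep_eq)
next
  case False
  then obtain j where j: "\<not> 0 \<le> q j + (if j = i then 1 else 0)" by blast
  have "walk_steps (i, n) v j \<noteq> q j" for v
    using j by (auto simp: walk_steps_def split: if_splits)
  then have "{v. walk_steps (i, n) v = q} = {}" by blast
  then show ?thesis unfolding step_prob_def if_not_P[OF False] by simp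
qed

section \<open>Recovering the offspring array from a path\<close>

definition path_steps :: "('t \<Rightarrow> nat \<Rightarrow> 't \<Rightarrow> int) \<Rightarrow> 't \<times> nat \<Rightarrow> 't \<Rightarrow> nat" where
  "path_steps y = (\<lambda>(i, n) j. nat (y i (Suc n) j - y i n j + (if j = i then 1 else 0)))"

text \<open>The paths from the origin on which \<open>nat\<close> in \<open>path_steps\<close>
  truncates nothing, so that they can be rebuilt from their steps. Coding walks are always of this
  kind, hence copies of them almost surely.\<close>

definition coding_path :: "('t \<Rightarrow> nat \<Rightarrow> 't \<Rightarrow> int) \<Rightarrow> bool" where
  "coding_path y \<longleftrightarrow> (\<forall>i j. y i 0 j = 0) \<and>
     (\<forall>i n j. 0 \<le> y i (Suc n) j - y i n j + (if j = i then 1 else 0))"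

lemma coding_path_coding_walk: "coding_path (coding_walk f)"
  unfolding coding_path_def coding_walk_Suc by (simp add: coding_walk_def)

lemma path_steps_coding_walk: "path_steps (coding_walk f) = offspring_array f"
  by (auto simp: path_steps_def offspring_array_def coding_walk_Suc fun_eq_iff)

lemma coding_walk_eq_path:
  assumes "coding_path y" "offspring_array f = path_steps y"
  shows "coding_walk f = y"
proof (intro ext)
  fix i n j
  show "coding_walk f i n j = y i n j"
  proof (induction n)
    case 0
    then show ?case using assms(1) by (simp add: coding_walk_def coding_path_def)
  next
    case (Suc n)
    have "offspring (vertex_seq f i n) j = path_steps y (i, n) j"
      unfolding assms(2)[symmetric] by (simp add: offspring_array_def)
    then have "int (offspring (vertex_seq f i n) j) = y i (Suc n) j - y i n j + (if j = i then 1 else 0)"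
      using assms(1) by (simp add: path_steps_def coding_path_def)
    then show ?case using coding_walk_Suc[of f i n j] Suc by simp
  qed
qed

lemma measurable_count_space_binary:
  fixes f :: "'a \<Rightarrow> 'b::countable"
  assumes "f \<in> measurable M (count_space UNIV)" "g \<in> measurable M (count_space UNIV)"
  shows "(\<lambda>x. h (f x) (g x)) \<in> measurable M (count_space UNIV)"
proof (rule measurable_compose_countable[OF _ assms(1)])
  show "(\<lambda>x. h b (g x)) \<in> measurable M (count_space UNIV)" for b
    by (rule measurable_compose[OF assms(2)]) simp
qed

lemma measurable_finite_fun_count_space:
  fixes f :: "'a \<Rightarrow> 'i::finite \<Rightarrow> 'b::countable"
  assumes [measurable]: "\<And>j. (\<lambda>x. f x j) \<in> measurable M (count_space UNIV)"
  shows "f \<in> measurable M (count_space UNIV)"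
proof (subst measurable_count_space_eq_countable)
  show "f \<in> space M \<rightarrow> UNIV \<and> (\<forall>v\<in>UNIV. f -` {v} \<inter> space M \<in> sets M)"
  proof (intro conjI ballI)
    fix v :: "'i \<Rightarrow> 'b"
    have "f -` {v} \<inter> space M = {x \<in> space M. \<forall>j. f x j = v j}" by (auto simp: fun_eq_iff)
    also have "\<dots> \<in> sets M" by measurable
    finally show "f -` {v} \<inter> space M \<in> sets M" .
  qed simp
qed simp

lemma path_space_component:
  "(\<lambda>y. y i n j) \<in> measurable path_space (count_space UNIV)"
proof -
  have 1: "(\<lambda>y. y i) \<in> measurable path_space (Pi\<^sub>M UNIV (\<lambda>_::nat. Pi\<^sub>M UNIV (\<lambda>_::'a. count_space (UNIV :: int set))))"
    unfolding path_space_def by (rule measurable_component_singleton) simp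
  have 2: "(\<lambda>y. y n) \<in> measurable (Pi\<^sub>M UNIV (\<lambda>_::nat. Pi\<^sub>M UNIV (\<lambda>_::'a. count_space (UNIV :: int set))))
      (Pi\<^sub>M UNIV (\<lambda>_. count_space UNIV))"
    by (rule measurable_component_singleton) simp
  have 3: "(\<lambda>y. y j) \<in> measurable (Pi\<^sub>M UNIV (\<lambda>_::'a. count_space (UNIV :: int set))) (count_space UNIV)"
    by (rule measurable_component_singleton) simp
  show ?thesis
    by (rule measurable_compose[OF measurable_compose[OF 1 2] 3])
qed

lemma path_steps_measurable:
  "path_steps \<in> measurable path_space (array_space :: ('t::finite \<times> nat \<Rightarrow> 't \<Rightarrow> nat) measure)"
proof -
  have "(\<lambda>y. path_steps y p) \<in> measurable path_space (count_space UNIV)" for p :: "'t \<times> nat"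
  proof (rule measurable_finite_fun_count_space)
    fix j
    show "(\<lambda>y. path_steps y p j) \<in> measurable path_space (count_space UNIV)"
      unfolding path_steps_def case_prod_beta
      by (rule measurable_count_space_binary[OF path_space_component path_space_component])
  qed
  then show ?thesis by (intro measurable_PiM_single') auto
qed

lemma coding_path_pred: "Measurable.pred path_space (coding_path :: ('t::finite \<Rightarrow> nat \<Rightarrow> 't \<Rightarrow> int) \<Rightarrow> bool)"
proof -
  have [measurable]: "Measurable.pred path_space (\<lambda>y. (y :: 't \<Rightarrow> nat \<Rightarrow> 't \<Rightarrow> int) i 0 j = 0)" for i j
    by (rule measurable_compose[OF path_space_component]) simp
  have [measurable]: "Measurable.pred path_space
      (\<lambda>y. 0 \<le> (y :: 't \<Rightarrow> nat \<Rightarrow> 't \<Rightarrow> int) i (Suc n) j - y i n j + (if j = i then 1 else 0))" for i j n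
    by (rule measurable_count_space_binary[OF path_space_component path_space_component])
  show ?thesis unfolding coding_path_def[abs_def] by measurable
qed

lemma coding_walk_measurable:
  fixes F :: "'w \<Rightarrow> nat \<Rightarrow> 't::{finite,linorder} ttree"
  assumes "F \<in> measurable M forest_space"
  shows "(\<lambda>\<omega>. coding_walk (F \<omega>)) \<in> measurable M path_space"
proof -
  have arr: "(\<lambda>\<omega>. offspring_array (F \<omega>)) \<in> measurable M array_space"
    by (rule measurable_compose[OF assms offspring_array_measurable])
  have comp: "(\<lambda>x. x p) \<in> measurable array_space (count_space (UNIV :: ('t \<Rightarrow> nat) set))" for p :: "'t \<times> nat"
    by (rule measurable_component_singleton) simp
  have rv: "(\<lambda>\<omega>. offspring_array (F \<omega>) p) \<in> measurable M (count_space UNIV)" for p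
    by (rule measurable_compose[OF arr comp])
  have "(\<lambda>\<omega>. coding_walk (F \<omega>) i n j) \<in> measurable M (count_space UNIV)" for i n j
  proof (induction n)
    case 0
    then show ?case by (simp add: coding_walk_def)
  next
    case (Suc n)
    have "(\<lambda>\<omega>. coding_walk (F \<omega>) i (Suc n) j) = (\<lambda>\<omega>. (\<lambda>a q. a + walk_steps (i, n) q j)
        (coding_walk (F \<omega>) i n j) (offspring_array (F \<omega>) (i, n)))"
      by (simp add: fun_eq_iff coding_walk_increment[symmetric])
    also have "\<dots> \<in> measurable M (count_space UNIV)"
      by (rule measurable_count_space_binary[OF Suc rv])
    finally show ?case .
  qed
  then show ?thesis
    unfolding path_space_def by (intro measurable_PiM_single') (auto simp: space_PiM)
qed

theorem theorem3p1:
  fixes \<nu> :: "'t::{finite,linorder} \<Rightarrow> ('t \<Rightarrow> nat) pmf"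
    and Pc :: "(nat \<Rightarrow> 't) \<Rightarrow> 'w measure"
    and F :: "'w \<Rightarrow> nat \<Rightarrow> 't ttree"
  assumes d2: "CARD('t) \<ge> 2"
    and irr: "irreducible_law \<nu>"
    and nondeg: "nondegenerate_law \<nu>"
    and crit: "critical_or_subcritical \<nu>"
    and same_space: "\<And>c c'. sets (Pc c) = sets (Pc c')"
    and forest: "\<And>c. branching_forest (Pc c) F \<nu> c"
  shows
    \<comment> \<open>Part 1\<close>
    "(\<forall>c.
       prob_space.indep_vars (Pc c) (\<lambda>_. count_space UNIV)
         (\<lambda>(i, n) \<omega>. (\<lambda>j. coding_walk (F \<omega>) i (Suc n) j - coding_walk (F \<omega>) i n j)) UNIV
     \<and> (\<forall>i n q. measure (Pc c) {\<omega> \<in> space (Pc c).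
            (\<lambda>j. coding_walk (F \<omega>) i (Suc n) j - coding_walk (F \<omega>) i n j) = q}
          = step_prob \<nu> i q)
     \<and> (\<forall>i. (\<forall>\<omega> n. coding_walk (F \<omega>) i (Suc n) i \<ge> coding_walk (F \<omega>) i n i - 1)
          \<and> (AE \<omega> in Pc c. liminf (\<lambda>n. ereal (real_of_int (coding_walk (F \<omega>) i n i))) = -\<infinity>))
     \<and> (\<forall>i j. i \<noteq> j \<longrightarrow> (\<forall>\<omega> n. coding_walk (F \<omega>) i n j \<le> coding_walk (F \<omega>) i (Suc n) j)))
   \<comment> \<open>Part 2\<close>
   \<and> (\<forall>c (r::nat). r \<ge> 1 \<longrightarrow>
       (AE \<omega> in Pc c. \<exists>rv :: 't \<Rightarrow> nat. (\<Sum>j\<in>UNIV. rv j) = r \<and>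
            (\<exists>n. smallest_solution rv (coding_walk (F \<omega>)) n)))
   \<comment> \<open>Part 3\<close>
   \<and> (\<forall>(N :: 'b measure) Y c c'.
       prob_space N \<and> Y \<in> measurable N path_space
       \<and> distr N path_space Y = distr (Pc c') path_space (\<lambda>\<omega>. coding_walk (F \<omega>))
       \<longrightarrow> (\<exists>G. branching_forest N G \<nu> c \<and>
              (AE \<omega> in N. coding_walk (G \<omega>) = Y \<omega> \<and>
                 (\<forall>f. (\<forall>k. wf_tree (f k) \<and> rtype (f k) = c k) \<and> (\<forall>i. subforest_infinite f i)
                      \<and> coding_walk f = Y \<omega> \<longrightarrow> f = G \<omega>))))"
proof -
  \<comment> \<open>Taken from the forest whose roots all have type \<open>j\<close>.\<close>
  have pos: "\<exists>t. gw_weight \<nu> j t > 0" for j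
    by (rule exists_positive_gw_weight[OF forest])
  note law = distr_offspring_array[OF irr pos forest]
  note Fm = branching_forestD(5)[OF forest]
  have part1: "prob_space.indep_vars (Pc c) (\<lambda>_. count_space UNIV)
         (\<lambda>(i, n) \<omega>. (\<lambda>j. coding_walk (F \<omega>) i (Suc n) j - coding_walk (F \<omega>) i n j)) UNIV
     \<and> (\<forall>i n q. measure (Pc c) {\<omega> \<in> space (Pc c).
            (\<lambda>j. coding_walk (F \<omega>) i (Suc n) j - coding_walk (F \<omega>) i n j) = q}
          = step_prob \<nu> i q)
     \<and> (\<forall>i. (\<forall>\<omega> n. coding_walk (F \<omega>) i (Suc n) i \<ge> coding_walk (F \<omega>) i n i - 1)
          \<and> (AE \<omega> in Pc c. liminf (\<lambda>n. ereal (real_of_int (coding_walk (F \<omega>) i n i))) = -\<infinity>))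
     \<and> (\<forall>i j. i \<noteq> j \<longrightarrow> (\<forall>\<omega> n. coding_walk (F \<omega>) i n j \<le> coding_walk (F \<omega>) i (Suc n) j))" for c
  proof -
    interpret prob_space "Pc c" by (rule branching_forestD(1)[OF forest])
    note ind = offspring_array_indep[OF Fm prob_space_axioms law]
    have "indep_vars (\<lambda>_. count_space UNIV) (\<lambda>p \<omega>. walk_steps p (offspring_array (F \<omega>) p)) UNIV"
      by (rule indep_vars_compose2[OF ind(1)]) simp
    moreover have "(\<lambda>(i, n) \<omega>. (\<lambda>j. coding_walk (F \<omega>) i (Suc n) j - coding_walk (F \<omega>) i n j)) =
        (\<lambda>p \<omega>. walk_steps p (offspring_array (F \<omega>) p))"
      unfolding coding_walk_increment by (simp add: fun_eq_iff)
    moreover have "measure (Pc c) {\<omega> \<in> space (Pc c).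
        (\<lambda>j. coding_walk (F \<omega>) i (Suc n) j - coding_walk (F \<omega>) i n j) = q} = step_prob \<nu> i q" for i n q
    proof -
      have rv: "(\<lambda>\<omega>. offspring_array (F \<omega>) (i, n)) \<in> measurable (Pc c) (count_space UNIV)"
        using ind(1) by (auto simp: indep_vars_def)
      have "step_prob \<nu> i q = measure (distr (Pc c) (count_space UNIV) (\<lambda>\<omega>. offspring_array (F \<omega>) (i, n)))
          {v. walk_steps (i, n) v = q}"
        by (simp only: ind(2) prob_walk_steps)
      also have "\<dots> = measure (Pc c) {\<omega> \<in> space (Pc c). walk_steps (i, n) (offspring_array (F \<omega>) (i, n)) = q}"
        by (subst measure_distr[OF rv]) (auto simp: vimage_def Int_def conj_commute)
      finally show ?thesis by (simp only: coding_walk_increment)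
    qed
    moreover have "AE \<omega> in Pc c. liminf (\<lambda>n. ereal (real_of_int (coding_walk (F \<omega>) i n i))) = -\<infinity>" for i
      using branching_forest_subforest_infinite[OF irr pos forest]
      by eventually_elim (simp add: liminf_coding_walk)
    ultimately show ?thesis
      using coding_walk_skip_free coding_walk_mono by metis
  qed
  have part2: "AE \<omega> in Pc c. \<exists>rv :: 't \<Rightarrow> nat. (\<Sum>j\<in>UNIV. rv j) = r \<and>
            (\<exists>n. smallest_solution rv (coding_walk (F \<omega>)) n)" for c r
    by (intro AE_I2 coding_system_solvable)
  have part3: "\<exists>G. branching_forest N G \<nu> c \<and>
              (AE \<omega> in N. coding_walk (G \<omega>) = Y \<omega> \<and>
                 (\<forall>f. (\<forall>k. wf_tree (f k) \<and> rtype (f k) = c k) \<and> (\<forall>i. subforest_infinite f i)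
                      \<and> coding_walk f = Y \<omega> \<longrightarrow> f = G \<omega>))"
    if N: "prob_space N" and Y: "Y \<in> measurable N path_space"
      and YX: "distr N path_space Y = distr (Pc c') path_space (\<lambda>\<omega>. coding_walk (F \<omega>))"
    for N :: "'b measure" and Y c c'
  proof -
    note W = coding_walk_measurable[OF Fm[of c']]
    \<comment> \<open>Only the law of \<open>Y\<close> is given, so the forest is decoded from the
      increments of \<open>Y\<close>, outcome by outcome.\<close>
    define x where "x = (\<lambda>\<omega>. path_steps (Y \<omega>))"
    have x: "x \<in> measurable N array_space"
      unfolding x_def by (rule measurable_compose[OF Y path_steps_measurable])
    have "distr N array_space x = distr (distr N path_space Y) array_space path_steps"
      by (simp add: distr_distr[OF path_steps_measurable Y] comp_def x_def)
    also have "\<dots> = distr (Pc c') array_space (\<lambda>\<omega>. path_steps (coding_walk (F \<omega>)))"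
      unfolding YX by (simp add: distr_distr[OF path_steps_measurable W] comp_def)
    \<comment> \<open>The array law carries no trace of \<open>c'\<close>, so \<open>Y\<close> can
      be decoded with the root sequence \<open>c\<close>.\<close>
    finally have xlaw: "distr N array_space x = array_law \<nu>"
      by (simp only: path_steps_coding_walk law)
    have "AE \<omega> in Pc c'. coding_path (coding_walk (F \<omega>))"
      by (simp add: coding_path_coding_walk)
    then have "AE y in distr N path_space Y. coding_path y"
      unfolding YX by (subst AE_distr_iff[OF W]) (use coding_path_pred in \<open>auto simp: pred_def\<close>)
    then have path: "AE \<omega> in N. coding_path (Y \<omega>)" by (rule AE_distrD[OF Y])
    have "AE z in distr N array_space x. offspring_array (decode c z) = z"
      unfolding xlaw by (rule AE_offspring_array_decode[OF irr pos forest])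
    then have dec: "AE \<omega> in N. offspring_array (decode c (x \<omega>)) = x \<omega>" by (rule AE_distrD[OF x])
    have "AE \<omega> in N. coding_walk (decode c (x \<omega>)) = Y \<omega> \<and>
        (\<forall>f. (\<forall>k. wf_tree (f k) \<and> rtype (f k) = c k) \<and> (\<forall>i. subforest_infinite f i)
          \<and> coding_walk f = Y \<omega> \<longrightarrow> f = decode c (x \<omega>))"
      using path dec
    proof eventually_elim
      case (elim \<omega>)
      have "coding_walk (decode c (x \<omega>)) = Y \<omega>"
        using elim by (intro coding_walk_eq_path) (simp_all add: x_def)
      \<comment> \<open>Any forest with coding walk \<open>Y \<omega>\<close> has offspring array
        \<open>x \<omega>\<close>; hence \<open>x \<omega>\<close> codes all its finite prefixes,
        and decoding is unique.\<close>
      moreover have "f = decode c (x \<omega>)"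
        if "\<And>k. wf_tree (f k) \<and> rtype (f k) = c k" "coding_walk f = Y \<omega>" for f
      proof -
        have "x \<omega> = offspring_array f"
          unfolding x_def that(2)[symmetric] by (rule path_steps_coding_walk)
        then show ?thesis
          using decode_unique[of f c "x \<omega>", OF that(1)] codes_forest_offspring_array[of f] by simp
      qed
      ultimately show ?case by blast
    qed
    with branching_forest_decode[OF forest[of c] N x xlaw] show ?thesis by blast
  qed
  show ?thesis
  proof (intro conjI allI impI)
    fix N :: "'b measure" and Y c c'
    assume "prob_space N \<and> Y \<in> measurable N path_space
      \<and> distr N path_space Y = distr (Pc c') path_space (\<lambda>\<omega>. coding_walk (F \<omega>))"
    then show "\<exists>G. branching_forest N G \<nu> c \<and>
        (AE \<omega> in N. coding_walk (G \<omega>) = Y \<omega> \<and>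
           (\<forall>f. (\<forall>k. wf_tree (f k) \<and> rtype (f k) = c k) \<and> (\<forall>i. subforest_infinite f i)
                \<and> coding_walk f = Y \<omega> \<longrightarrow> f = G \<omega>))"
      by (intro part3) auto
  qed (use part1 part2 in auto)
qed

end
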